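(* Let $P \subset \mathbb{E}^d$ be a primitive polytope. Then $\operatorname{Ill}(P) \le 2^d$, and equality $\operatorname{Ill}(P) = 2^d$ holds if and only if $P$ is the image of a $d$-dimensional cube under some invertible linear transformation.
   Context: $\mathbb{E}^d$ is $d$-dimensional Euclidean space with origin $\mathbf{o}$ and unit sphere $\mathbb{S}^{d-1}$. A convex polytope in $\mathbb{E}^d$ is the convex hull of finitely many points having nonempty interior; equivalently, a bounded set with nonempty interior that is the intersection of finitely many closed halfspaces. All polytopes are convex and are assumed to contain $\mathbf{o}$ in their interior. Write $P = H_1^- \cap \dots \cap H_n^-$ for the irredundant representation of $P$ as an intersection of closed halfspaces, one for each facet of $P$. The polytope $P$ is primitive if omitting any of the halfspaces $H_i^-$ (equivalently, any nonempty set of them) makes the intersection of the remaining ones unbounded. A boundary point $\mathbf{x}$ of $P$ is illuminated by a direction $\mathbf{u} \in \mathbb{S}^{d-1}$ if the ray $\{\mathbf{x} + t\mathbf{u} : t \ge 0\}$ intersects the interior of $P$. A set of directions illuminates $P$ if every boundary point of $P$ is illuminated by at least one direction in the set. The illumination number $\operatorname{Ill}(P)$ is the smallest number of directions that illuminate $P$. A $d$-dimensional cube is any subset of $\mathbb{E}^d$ congruent to $[0,s]^d$ for some $s>0$ (it need not be centred at the origin). *)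

theory Defs
  imports "HOL-Analysis.Analysis"
begin

text \<open>
  The ambient Euclidean space is a type \<open>'a::euclidean_space\<close>, its dimension is \<open>DIM('a)\<close>.
  A convex polytope containing the origin in its interior is a set \<open>P\<close> with \<open>polytope P\<close>
  (the convex hull of a finite set) and \<open>0 \<in> interior P\<close>.
\<close>

text \<open>
  The set \<open>{H\<^sub>1\<^sup>-, \<dots>, H\<^sub>n\<^sup>-}\<close> of the closed halfspaces of the irredundant representation of \<open>P\<close>:
  those containing \<open>P\<close> whose bounding hyperplane cuts out a facet of \<open>P\<close>. The lemmas below
  confirm that for a polytope with nonempty interior this is a finite family with
  intersection \<open>P\<close>, and that it is the only irredundant such family.
\<close>

definition facet_halfspaces :: "'a::euclidean_space set \<Rightarrow> 'a set set" where
  "facet_halfspaces P =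
     {H. \<exists>a b. a \<noteq> 0 \<and> H = {x. a \<bullet> x \<le> b} \<and> P \<subseteq> H \<and> (P \<inter> {x. a \<bullet> x = b}) facet_of P}"

definition primitive :: "'a::euclidean_space set \<Rightarrow> bool" where
  "primitive P \<longleftrightarrow> (\<forall>H \<in> facet_halfspaces P. \<not> bounded (\<Inter>(facet_halfspaces P - {H})))"

definition illuminated_by :: "'a::euclidean_space set \<Rightarrow> 'a \<Rightarrow> 'a \<Rightarrow> bool" where
  "illuminated_by P x u \<longleftrightarrow> {x + t *\<^sub>R u | t. 0 \<le> t} \<inter> interior P \<noteq> {}"

definition illuminates :: "'a::euclidean_space set \<Rightarrow> 'a set \<Rightarrow> bool" where
  "illuminates U P \<longleftrightarrow> (\<forall>x \<in> frontier P. \<exists>u \<in> U. illuminated_by P x u)"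

text \<open>
  The values are extended naturals, so that the infimum is \<open>\<infinity>\<close> if no finite set of directions
  illuminates \<open>P\<close>; otherwise it is attained.
\<close>

definition Ill :: "'a::euclidean_space set \<Rightarrow> enat" where
  "Ill P = Inf {enat (card U) | U. finite U \<and> U \<subseteq> sphere 0 1 \<and> illuminates U P}"

definition is_cube :: "'a::euclidean_space set \<Rightarrow> bool" where
  "is_cube C \<longleftrightarrow> (\<exists>s>0. \<exists>g::'a \<Rightarrow> 'a. (\<forall>x y. dist (g x) (g y) = dist x y) \<and>
     C = g ` {x. \<forall>i\<in>Basis. 0 \<le> x \<bullet> i \<and> x \<bullet> i \<le> s})"

lemma halfspace_eq_of_facet:
  fixes P :: "'a::euclidean_space set"
  assumes int: "interior P \<noteq> {}" and a: "a \<noteq> 0" and c: "c \<noteq> 0"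
    and aP: "P \<subseteq> {x. a \<bullet> x \<le> b}" and cP: "P \<subseteq> {x. c \<bullet> x \<le> e}"
    and F: "F facet_of P" and Fa: "F \<subseteq> {x. a \<bullet> x = b}" and Fc: "F \<subseteq> {x. c \<bullet> x = e}"
  shows "{x. a \<bullet> x \<le> b} = {x. c \<bullet> x \<le> e}"
proof -
  have dimP: "aff_dim P = int (DIM('a))"
    using int by (simp add: aff_dim_nonempty_interior)
  have dF: "aff_dim F = int (DIM('a)) - 1"
    using F dimP by (simp add: facet_of_def)
  have hyp: "affine hull F = {x. v \<bullet> x = r}"
    if "v \<noteq> 0" "F \<subseteq> {x. v \<bullet> x = r}" for v :: 'a and r
  proof -
    have "aff_dim F = aff_dim {x. v \<bullet> x = r}"
      using dF that(1) by (simp add: aff_dim_hyperplane)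
    then show ?thesis
      using that(2) affine_hyperplane
      by (metis aff_dim_eq_full_gen affine_hull_eq)
  qed
  have eq: "{x. a \<bullet> x = b} = {x. c \<bullet> x = e}"
    using hyp[OF a Fa] hyp[OF c Fc] by simp
  obtain p where p: "p \<in> interior P" using int by auto
  have lt: "v \<bullet> p < r" if "v \<noteq> 0" "P \<subseteq> {x. v \<bullet> x \<le> r}" for v :: 'a and r
    using interior_mono[OF that(2)] p that(1) by (auto simp: interior_halfspace_le)
  have sub: "v \<bullet> y \<le> r"
    if "v \<bullet> p < r" "w \<bullet> p < q" "w \<bullet> y \<le> q" "{x. v \<bullet> x = r} = {x. w \<bullet> x = q}"
    for v w y :: 'a and r q
  proof (rule ccontr)
    assume n: "\<not> v \<bullet> y \<le> r"
    define t where "t = (r - v \<bullet> p) / (v \<bullet> y - v \<bullet> p)"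
    have t: "0 < t" "t < 1" and tt: "t * (v \<bullet> y - v \<bullet> p) = r - v \<bullet> p"
      using n that(1) by (auto simp: t_def divide_simps)
    define z where "z = (1 - t) *\<^sub>R p + t *\<^sub>R y"
    have "v \<bullet> z = r" using tt by (simp add: z_def inner_add_right algebra_simps)
    then have "w \<bullet> z = q" using that(4) by auto
    moreover have "w \<bullet> z < q"
    proof -
      have "(1 - t) * (w \<bullet> p) < (1 - t) * q" "t * (w \<bullet> y) \<le> t * q"
        using t that(2,3) by auto
      then have "(1 - t) * (w \<bullet> p) + t * (w \<bullet> y) < q"
        by (simp add: algebra_simps)
      then show ?thesis by (simp add: z_def inner_add_right)
    qed
    ultimately show False by simp
  qed
  show ?thesis
    using sub[OF lt[OF a aP] lt[OF c cP] _ eq] sub[OF lt[OF c cP] lt[OF a aP] _ eq[symmetric]]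
    by blast
qed

lemma facet_halfspaces_irredundant:
  fixes P :: "'a::euclidean_space set"
  assumes int: "interior P \<noteq> {}" and fin: "finite \<H>"
    and half: "\<And>h. h \<in> \<H> \<Longrightarrow> \<exists>a b. a \<noteq> 0 \<and> h = {x. a \<bullet> x \<le> b}"
    and P: "P = \<Inter>\<H>" and irred: "\<And>\<G>. \<G> \<subset> \<H> \<Longrightarrow> \<Inter>\<G> \<noteq> P"
  shows "facet_halfspaces P = \<H>"
proof -
  obtain a b where ab: "\<And>h. h \<in> \<H> \<Longrightarrow> a h \<noteq> 0 \<and> h = {x. a h \<bullet> x \<le> b h}"
    using half by metis
  have aff: "affine hull P = UNIV"
    using int by (simp add: affine_hull_nonempty_interior)
  have facet: "C facet_of P \<longleftrightarrow> (\<exists>h. h \<in> \<H> \<and> C = P \<inter> {x. a h \<bullet> x = b h})" for C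
  proof (rule facet_of_polyhedron_explicit[OF fin _ ab])
    show "P = affine hull P \<inter> \<Inter>\<H>" using aff P by simp
    show "P \<subset> affine hull P \<inter> \<Inter>\<G>" if "\<G> \<subset> \<H>" for \<G>
      using irred[OF that] that aff P by auto
  qed
  show ?thesis
  proof
    show "\<H> \<subseteq> facet_halfspaces P"
    proof
      fix h assume h: "h \<in> \<H>"
      then have "(P \<inter> {x. a h \<bullet> x = b h}) facet_of P" using facet by blast
      then show "h \<in> facet_halfspaces P"
        unfolding facet_halfspaces_def using ab[OF h] h P by blast
    qed
    show "facet_halfspaces P \<subseteq> \<H>"
    proof
      fix H assume "H \<in> facet_halfspaces P"
      then obtain c e where ce: "c \<noteq> 0" "H = {x. c \<bullet> x \<le> e}" "P \<subseteq> H"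
        and F: "(P \<inter> {x. c \<bullet> x = e}) facet_of P"
        unfolding facet_halfspaces_def by blast
      obtain h where h: "h \<in> \<H>" and eq: "P \<inter> {x. c \<bullet> x = e} = P \<inter> {x. a h \<bullet> x = b h}"
        using iffD1[OF facet F] by (elim exE conjE)
      have h2: "a h \<noteq> 0" "h = {x. a h \<bullet> x \<le> b h}" using ab[OF h] by blast+
      have "P \<subseteq> h" using h P by blast
      then have "P \<subseteq> {x. c \<bullet> x \<le> e}" "P \<subseteq> {x. a h \<bullet> x \<le> b h}"
        using ce(2,3) h2(2) by simp_all
      moreover have "P \<inter> {x. c \<bullet> x = e} \<subseteq> {x. a h \<bullet> x = b h}"
        by (subst eq) (rule Int_lower2)
      ultimately have "{x. c \<bullet> x \<le> e} = {x. a h \<bullet> x \<le> b h}"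
        using halfspace_eq_of_facet[OF int ce(1) h2(1) _ _ F Int_lower2] by simp
      then have "H = h" by (simp only: ce(2) h2(2)[symmetric])
      then show "H \<in> \<H>" using h by simp
    qed
  qed
qed

lemma polytope_facet_halfspaces:
  fixes P :: "'a::euclidean_space set"
  assumes "polytope P" and int: "interior P \<noteq> {}"
  shows "finite (facet_halfspaces P)" and "\<Inter>(facet_halfspaces P) = P"
proof -
  have aff: "affine hull P = UNIV"
    using int by (simp add: affine_hull_nonempty_interior)
  obtain \<H> where H: "finite \<H>" "P = \<Inter>\<H>"
      "\<And>h. h \<in> \<H> \<Longrightarrow> \<exists>a b. a \<noteq> 0 \<and> h = {x. a \<bullet> x \<le> b}"
      "\<And>\<G>. \<G> \<subset> \<H> \<Longrightarrow> P \<subset> \<Inter>\<G>"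
    using polytope_imp_polyhedron[OF assms(1)] aff
    by (auto simp: polyhedron_Int_affine_minimal)
  have "facet_halfspaces P = \<H>"
    using facet_halfspaces_irredundant[OF int H(1) H(3) H(2)] H(4) by blast
  then show "finite (facet_halfspaces P)" and "\<Inter>(facet_halfspaces P) = P"
    using H by auto
qed

end

theory Submission
  imports Defs
begin

text \<open>
  Write \<open>P\<close> as \<open>{x. v i \<bullet> x \<le> 1 for all i}\<close>. A direction \<open>u\<close> illuminates a boundary point as soon as
  \<open>v i \<bullet> u < 0\<close> for every facet \<open>i\<close> through the point, so \<open>Ill P\<close> is at most the number of maximal
  index sets \<open>J\<close> that lie in an open halfspace (\<open>v i \<bullet> u < 0\<close> on \<open>J\<close> for some \<open>u\<close>). Primitivity
  means that every normal \<open>v q\<close> can be separated from the others by a hyperplane through the origin.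
  Using such a hyperplane one either splits the maximal sets according to whether they contain
  \<open>q\<close>, each part being counted in dimension \<open>d - 1\<close>, or finds a second normal \<open>v p\<close> such that the
  pair \<open>p, q\<close> can be merged into one normal in dimension \<open>d - 1\<close>. A merged index may lose the
  separation property, so it is marked, and maximal sets are weighted by \<open>1/2\<close> per marked index
  they contain. When only marked indices are left, a Kraft-type inequality bounds the weight.
  Equality forces all normals to come in merged pairs, that is, opposite normals of a parallelotope.
\<close>

section \<open>Maximal index sets in an open halfspace\<close>

text \<open>Maximal sets containing \<open>q\<close> live on the hyperplane orthogonal to
  \<open>v q\<close>, those avoiding \<open>q\<close> on the hyperplane orthogonal to a separator
  \<open>u\<close> of \<open>q\<close>; if both halves satisfied the hypotheses, two copies of the
  bound for dimension d - 1 would add up to 2^d. The obstacle is that some other \<open>p\<close>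
  may have no separator on the first hyperplane. Balance makes this failure rigid: a separator
  \<open>w\<close> of \<open>p\<close>, corrected by a multiple of \<open>u\<close> so as to
  annihilate \<open>v q\<close>, is nonnegative on all normals, hence zero on all of them, and this
  forces \<open>u\<close> to vanish on every normal except \<open>v p\<close> and
  \<open>v q\<close>. On the hyperplane orthogonal to \<open>u\<close> these two can be replaced by
  the one positive combination that annihilates \<open>u\<close>, and the factor 2 then comes from
  the merge instead of from a split. The induction runs over subspaces \<open>S\<close> of the fixed
  ambient space. Only the values of the functionals \<open>v i\<close> on \<open>S\<close> matter,
  so contraction and deletion leave the vectors themselves untouched.\<close>

definition feasible :: "'a::euclidean_space set \<Rightarrow> ('i \<Rightarrow> 'a) \<Rightarrow> 'i set \<Rightarrow> bool" where
  "feasible S v J \<longleftrightarrow> (\<exists>u\<in>S. \<forall>i\<in>J. v i \<bullet> u < 0)"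

text \<open>Testing one additional index at a time is enough for maximality, because feasibility
  passes to subsets.\<close>

definition max_feasible :: "'a::euclidean_space set \<Rightarrow> ('i \<Rightarrow> 'a) \<Rightarrow> 'i set \<Rightarrow> 'i set set" where
  "max_feasible S v I = {J. J \<subseteq> I \<and> feasible S v J \<and> (\<forall>i\<in>I - J. \<not> feasible S v (insert i J))}"

lemma feasible_mono: "feasible S v J \<Longrightarrow> J' \<subseteq> J \<Longrightarrow> feasible S v J'"
  unfolding feasible_def by blast

lemma max_feasibleD:
  assumes "J \<in> max_feasible S v I"
  shows "J \<subseteq> I" "feasible S v J" "\<And>i. i \<in> I \<Longrightarrow> feasible S v (insert i J) \<Longrightarrow> i \<in> J"
  using assms unfolding max_feasible_def by auto

lemma finite_max_feasible [simp]: "finite I \<Longrightarrow> finite (max_feasible S v I)"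
  unfolding max_feasible_def by (rule finite_subset[of _ "Pow I"]) auto

lemma feasible_extend:
  assumes "finite I" "J \<subseteq> I" "feasible S v J"
  obtains J' where "J \<subseteq> J'" "J' \<in> max_feasible S v I"
proof -
  define X where "X = {J'. J \<subseteq> J' \<and> J' \<subseteq> I \<and> feasible S v J'}"
  have "finite X" unfolding X_def using assms(1) by (auto intro: finite_subset[of _ "Pow I"])
  moreover have "J \<in> X" using assms unfolding X_def by auto
  ultimately obtain J' where J': "J' \<in> X" "J \<subseteq> J'" "\<And>y. y \<in> X \<Longrightarrow> J' \<subseteq> y \<Longrightarrow> J' = y"
    using finite_has_maximal2[of X J] by auto
  have "J' \<in> max_feasible S v I"
    unfolding max_feasible_def
  proof (safe)
    show "x \<in> I" if "x \<in> J'" for x using that J'(1) unfolding X_def by auto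
    show "feasible S v J'" using J'(1) unfolding X_def by auto
    fix i assume i: "i \<in> I" "i \<notin> J'" "feasible S v (insert i J')"
    then have "insert i J' \<in> X" using J'(1) unfolding X_def by auto
    then show False using J'(3)[of "insert i J'"] i by auto
  qed
  then show thesis using J'(2) that by blast
qed

section \<open>The Kraft-type inequality for maximal index sets\<close>

text \<open>Squaring the weak inequality at \<open>x / 2\<close> leaves a spare term x^2/4; the case
  split secures a nonnegative base for the squaring.\<close>

lemma exp_gt_add_one_self: "x \<noteq> 0 \<Longrightarrow> 1 + x < exp (x::real)"
proof -
  assume "x \<noteq> 0"
  show ?thesis
  proof (cases "1 + x / 2 < 0")
    case True
    then have "1 + x < 0" by simp
    then show ?thesis using exp_gt_zero[of x] by linarith
  next
    case False
    then have "(1 + x / 2)\<^sup>2 \<le> (exp (x / 2))\<^sup>2"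
      by (intro power_mono) auto
    also have "\<dots> = exp x" by (simp add: power2_eq_square flip: exp_add)
    finally have "1 + x + x\<^sup>2 / 4 \<le> exp x" by (simp add: power2_eq_square algebra_simps)
    moreover have "x\<^sup>2 > 0" using \<open>x \<noteq> 0\<close> by simp
    ultimately show ?thesis by linarith
  qed
qed

text \<open>Each \<open>f b\<close> is the convex combination of \<open>f b + t * g b\<close> and
  \<open>f b - g b\<close> with weights 1/(1+t) and t/(1+t); this is strict convexity cleared of
  denominators. The linear parts cancel exactly, so all strictness comes from
  \<open>exp\<close>.\<close>

lemma exp_sum_strictly_convex:
  fixes f g :: "'b \<Rightarrow> real"
  assumes "finite B" "0 < t" "b \<in> B" "g b \<noteq> 0"
  shows "(1 + t) * (\<Sum>b\<in>B. f b + exp (f b)) <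
    (\<Sum>b\<in>B. (f b + t * g b) + exp (f b + t * g b)) + t * (\<Sum>b\<in>B. (f b - g b) + exp (f b - g b))"
proof -
  have step: "(1 + t) * exp z \<le> exp (z + t * d) + t * exp (z - d)" (is "?l \<le> ?r") and
    strict: "d \<noteq> 0 \<Longrightarrow> (1 + t) * exp z < exp (z + t * d) + t * exp (z - d)" for z d :: real
  proof -
    \<comment> \<open>After factoring out \<open>exp z\<close>, adding the tangent bounds at 0 for
      \<open>exp (t * d)\<close> and \<open>t * exp (- d)\<close> gives
      \<open>1 + t\<close>.\<close>
    have e: "?r = exp z * (exp (t * d) + t * exp (- d))"
      by (simp add: exp_add exp_diff exp_minus algebra_simps divide_inverse)
    have b: "t - t * d \<le> t * exp (- d)"
      using mult_left_mono[OF exp_ge_add_one_self[of "- d"], of t] \<open>0 < t\<close> by (simp add: algebra_simps)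
    have "1 + t \<le> exp (t * d) + t * exp (- d)"
      using exp_ge_add_one_self[of "t * d"] b by linarith
    then show "?l \<le> ?r" unfolding e by (simp add: mult.commute)
    assume "d \<noteq> 0"
    then have "t * d \<noteq> 0" using \<open>0 < t\<close> by simp
    then have "1 + t < exp (t * d) + t * exp (- d)"
      using exp_gt_add_one_self[of "t * d"] b by linarith
    then show "?l < ?r" unfolding e by (simp add: mult.commute)
  qed
  have "(\<Sum>b\<in>B. (1 + t) * (f b + exp (f b))) <
    (\<Sum>b\<in>B. ((f b + t * g b) + exp (f b + t * g b)) + t * ((f b - g b) + exp (f b - g b)))"
  proof (rule sum_strict_mono_ex1[OF assms(1)])
    have e: "(1 + t) * (f b + exp (f b)) = (1 + t) * f b + (1 + t) * exp (f b)"
      "((f b + t * g b) + exp (f b + t * g b)) + t * ((f b - g b) + exp (f b - g b)) =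
       (1 + t) * f b + (exp (f b + t * g b) + t * exp (f b - g b))" for b
      by (simp_all add: algebra_simps)
    show "\<forall>b\<in>B. (1 + t) * (f b + exp (f b)) \<le> ((f b + t * g b) + exp (f b + t * g b)) + t * ((f b - g b) + exp (f b - g b))"
      unfolding e using step by auto
    show "\<exists>b\<in>B. (1 + t) * (f b + exp (f b)) < ((f b + t * g b) + exp (f b + t * g b)) + t * ((f b - g b) + exp (f b - g b))"
      unfolding e using strict[of "g b" "f b"] assms(3,4) by auto
  qed
  then show ?thesis by (simp only: sum_distrib_left[symmetric] sum.distrib)
qed

text \<open>The set \<open>C\<close> may be unbounded in negative directions, where
  \<open>exp\<close> alone would stay bounded. The linear term makes the objective tend to minus
  infinity there, so its superlevel sets in \<open>C\<close> are compact.\<close>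

lemma maximizer_on_bounded_above_polyhedron:
  fixes S :: "'a::euclidean_space set"
  assumes S: "subspace S" and B: "finite B" "pairwise orthogonal B" "\<And>b. b \<in> B \<Longrightarrow> norm b = 1" "span B = S"
    and "closed C" "C \<subseteq> S" "C \<noteq> {}" and C: "\<And>x b. x \<in> C \<Longrightarrow> b \<in> B \<Longrightarrow> b \<bullet> x \<le> R"
  obtains x where "x \<in> C" "\<And>y. y \<in> C \<Longrightarrow> (\<Sum>b\<in>B. b \<bullet> y + exp (b \<bullet> y)) \<le> (\<Sum>b\<in>B. b \<bullet> x + exp (b \<bullet> x))"
proof -
  define \<phi> where "\<phi> x = (\<Sum>b\<in>B. b \<bullet> x + exp (b \<bullet> x))" for x
  obtain x0 where x0: "x0 \<in> C" using \<open>C \<noteq> {}\<close> by auto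
  define K where "K = C \<inter> {x. \<phi> x0 \<le> \<phi> x}"
  define L where "L = (\<Sum>b\<in>B. \<bar>R\<bar> + exp R)"
  have cont: "continuous_on UNIV \<phi>" unfolding \<phi>_def by (intro continuous_intros)
  have "closed K"
    unfolding K_def using closed_Collect_le[OF continuous_on_const cont] \<open>closed C\<close> by auto
  moreover have "bounded K"
  proof -
    have bnd: "\<bar>b \<bullet> x\<bar> \<le> \<bar>R\<bar> + \<bar>\<phi> x0\<bar> + L" if "x \<in> K" "b \<in> B" for x b
    proof -
      have x: "x \<in> C" "\<phi> x0 \<le> \<phi> x" using that(1) unfolding K_def by auto
      have le: "c \<bullet> x + exp (c \<bullet> x) \<le> \<bar>R\<bar> + exp R" if "c \<in> B" for c
        using C[OF x(1) that] exp_le_cancel_iff[of "c \<bullet> x" R] by linarith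
      have "\<phi> x = (b \<bullet> x + exp (b \<bullet> x)) + (\<Sum>c\<in>B - {b}. c \<bullet> x + exp (c \<bullet> x))"
        unfolding \<phi>_def using that(2) B(1) by (simp add: sum.remove)
      also have "\<dots> \<le> (b \<bullet> x + exp (b \<bullet> x)) + (\<Sum>c\<in>B - {b}. \<bar>R\<bar> + exp R)"
        by (intro add_left_mono sum_mono) (use le in auto)
      also have "\<dots> = b \<bullet> x + exp (b \<bullet> x) + L - (\<bar>R\<bar> + exp R)"
        unfolding L_def using sum.remove[OF B(1) that(2), of "\<lambda>_. \<bar>R\<bar> + exp R"] by simp
      finally have "\<phi> x0 \<le> b \<bullet> x + exp (b \<bullet> x) + L - (\<bar>R\<bar> + exp R)" using x(2) by simp
      moreover have "0 \<le> L" unfolding L_def by (intro sum_nonneg) simp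
      ultimately show ?thesis using C[OF x(1) that(2)] exp_le_cancel_iff[of "b \<bullet> x" R] by linarith
    qed
    have "norm x \<le> (\<Sum>b\<in>B. \<bar>R\<bar> + \<bar>\<phi> x0\<bar> + L)" if "x \<in> K" for x
    proof -
      have "x \<in> span B" using that \<open>C \<subseteq> S\<close> B(4) unfolding K_def by auto
      then have "x = (\<Sum>b\<in>B. (x \<bullet> b) *\<^sub>R b)" using orthonormal_basis_expand B by metis
      then have "norm x \<le> (\<Sum>b\<in>B. norm ((x \<bullet> b) *\<^sub>R b))" by (metis norm_sum)
      also have "\<dots> \<le> (\<Sum>b\<in>B. \<bar>R\<bar> + \<bar>\<phi> x0\<bar> + L)"
        by (intro sum_mono) (use bnd[OF that] B(3) in \<open>auto simp: inner_commute\<close>)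
      finally show ?thesis .
    qed
    then show ?thesis by (auto simp: bounded_iff)
  qed
  ultimately have "compact K" by (simp add: compact_eq_bounded_closed)
  moreover have "K \<noteq> {}" using x0 unfolding K_def by auto
  ultimately obtain x where x: "x \<in> K" "\<And>y. y \<in> K \<Longrightarrow> \<phi> y \<le> \<phi> x"
    using continuous_attains_sup[OF _ _ continuous_on_subset[OF cont subset_UNIV]] by metis
  show thesis
  proof
    show "x \<in> C" using x(1) unfolding K_def by auto
    show "(\<Sum>b\<in>B. b \<bullet> y + exp (b \<bullet> y)) \<le> (\<Sum>b\<in>B. b \<bullet> x + exp (b \<bullet> x))" if "y \<in> C" for y
    proof (cases "\<phi> x0 \<le> \<phi> y")
      case True
      then show ?thesis using x(2)[of y] that unfolding K_def \<phi>_def by auto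
    next
      case False
      then show ?thesis using x(1) unfolding K_def \<phi>_def by auto
    qed
  qed
qed

lemma feasible_margin:
  assumes "subspace S" "finite J" "feasible S v J"
  obtains x where "x \<in> S" "\<And>i. i \<in> J \<Longrightarrow> v i \<bullet> x \<le> -1"
proof -
  obtain u where u: "u \<in> S" "\<And>i. i \<in> J \<Longrightarrow> v i \<bullet> u < 0" using assms(3) unfolding feasible_def by auto
  \<comment> \<open>A sum of positive reciprocals dominates each of them, so one scaling reaches the
    margin for all of \<open>J\<close>.\<close>
  define c where "c = (\<Sum>i\<in>J. 1 / (- (v i \<bullet> u)))"
  show thesis
  proof
    show "c *\<^sub>R u \<in> S" using u(1) assms(1) by (simp add: subspace_scale)
    fix i assume i: "i \<in> J"
    have "1 / (- (v i \<bullet> u)) \<le> c" unfolding c_def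
      by (rule member_le_sum[OF i]) (use u(2) assms(2) in \<open>auto simp: divide_nonneg_neg less_imp_le\<close>)
    then have "1 \<le> c * (- (v i \<bullet> u))" using u(2)[OF i] by (simp add: field_simps)
    then show "v i \<bullet> (c *\<^sub>R u) \<le> - 1" by simp
  qed
qed

text \<open>A slack constraint survives a short step by continuity, a tight one because its slope is
  nonpositive.\<close>

lemma eventually_affine_le:
  fixes a d c :: real
  assumes "a \<le> c" "a = c \<Longrightarrow> d \<le> 0"
  shows "\<forall>\<^sub>F t in at_right 0. a + t * d \<le> c"
proof (cases "a = c")
  case True
  then show ?thesis using assms(2) eventually_at_right_less[of "0::real"]
    by (elim eventually_mono) (auto simp: mult_nonneg_nonpos)
next
  case False
  have "((\<lambda>t. a + t * d) \<longlongrightarrow> a + 0 * d) (at_right 0)" by (intro tendsto_intros)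
  then have "\<forall>\<^sub>F t in at_right 0. a + t * d < c"
    by (rule order_tendstoD) (use False assms(1) in auto)
  then show ?thesis by (rule eventually_mono) simp
qed

text \<open>
  Let \<open>z J\<close> maximize a strictly convex function, increasing along an orthonormal basis \<open>B\<close> of \<open>S\<close>,
  over the points of a box-bounded copy of the cone of \<open>J\<close>. The subsets \<open>Y\<close> of \<open>I\<close> that meet \<open>J\<close> exactly
  in the constraints tight at \<open>z J\<close>, together with the tight box constraints, determine \<open>J\<close>; there
  are \<open>2 ^ (card I - card J)\<close> of them among \<open>2 ^ (card I + dim S)\<close> pairs.
\<close>

lemma sum_half_power_max_feasible:
  fixes S :: "'a::euclidean_space set" and v :: "'i \<Rightarrow> 'a"
  assumes S: "subspace S" and I: "finite I"
  shows "(\<Sum>J\<in>max_feasible S v I. (1/2) ^ card J) \<le> (2::real) ^ dim S"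
    and "0 < dim S \<Longrightarrow> (\<Sum>J\<in>max_feasible S v I. (1/2) ^ card J) < (2::real) ^ dim S"
proof -
  obtain B where B0: "B \<subseteq> S" "pairwise orthogonal B" "\<And>x. x \<in> B \<Longrightarrow> norm x = 1"
     "independent B" "card B = dim S" "span B = S"
    using orthonormal_basis_subspace[OF S] by metis
  have finB: "finite B" using B0(4) independent_imp_finite by auto
  define M where "M = max_feasible S v I"
  have finM: "finite M" unfolding M_def using I by simp
  define \<phi> where "\<phi> x = (\<Sum>b\<in>B. b \<bullet> x + exp (b \<bullet> x))" for x
  have M: "J \<subseteq> I" "feasible S v J" "finite J" if "J \<in> M" for J
    using that max_feasibleD[of J S v I] finite_subset[OF _ I] unfolding M_def by auto
  have "\<forall>J\<in>M. \<exists>x. x \<in> S \<and> (\<forall>i\<in>J. v i \<bullet> x \<le> -1)"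
    using feasible_margin[OF S M(3) M(2)] by metis
  then obtain x0 where x0: "\<And>J. J \<in> M \<Longrightarrow> x0 J \<in> S \<and> (\<forall>i\<in>J. v i \<bullet> x0 J \<le> -1)" by metis
  \<comment> \<open>One bound serves all \<open>J\<close>: every \<open>C J\<close> contains
    \<open>x0 J\<close>, and a box constraint tight at both \<open>z J\<close> and
    \<open>z J'\<close> has the same value at both points.\<close>
  define R where "R = (\<Sum>J\<in>M. \<Sum>b\<in>B. \<bar>b \<bullet> x0 J\<bar>)"
  have R: "b \<bullet> x0 J \<le> R" if "J \<in> M" "b \<in> B" for J b
  proof -
    have "b \<bullet> x0 J \<le> \<bar>b \<bullet> x0 J\<bar>" by simp
    also have "\<dots> \<le> (\<Sum>b\<in>B. \<bar>b \<bullet> x0 J\<bar>)" by (rule member_le_sum) (use that finB in auto)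
    also have "\<dots> \<le> R" unfolding R_def
      by (rule member_le_sum[where f = "\<lambda>J. \<Sum>b\<in>B. \<bar>b \<bullet> x0 J\<bar>"]) (use that finM in \<open>auto intro: sum_nonneg\<close>)
    finally show ?thesis .
  qed
  define C where "C J = {x. x \<in> S \<and> (\<forall>i\<in>J. v i \<bullet> x \<le> -1) \<and> (\<forall>b\<in>B. b \<bullet> x \<le> R)}" for J
  have "\<exists>x. x \<in> C J \<and> (\<forall>y\<in>C J. \<phi> y \<le> \<phi> x)" if J: "J \<in> M" for J
  proof -
    have CJ: "C J = S \<inter> (\<Inter>i\<in>J. {x. v i \<bullet> x \<le> -1}) \<inter> (\<Inter>b\<in>B. {x. b \<bullet> x \<le> R})" unfolding C_def by auto
    have "closed (C J)" unfolding CJ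
      by (intro closed_Int closed_INT ballI closed_halfspace_le closed_subspace[OF S])
    moreover have "C J \<subseteq> S" unfolding C_def by auto
    moreover have "C J \<noteq> {}" using x0[OF J] R[OF J] unfolding C_def by auto
    moreover have "b \<bullet> x \<le> R" if "x \<in> C J" "b \<in> B" for b x using that unfolding C_def by auto
    ultimately obtain x where "x \<in> C J" "\<And>y. y \<in> C J \<Longrightarrow> \<phi> y \<le> \<phi> x"
      using maximizer_on_bounded_above_polyhedron[OF S finB B0(2,3,6), of "C J" R] unfolding \<phi>_def by blast
    then show ?thesis by blast
  qed
  then obtain z where z: "\<And>J. J \<in> M \<Longrightarrow> z J \<in> C J" "\<And>J y. J \<in> M \<Longrightarrow> y \<in> C J \<Longrightarrow> \<phi> y \<le> \<phi> (z J)"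
    by metis
  define tI where "tI J = {i\<in>J. v i \<bullet> z J = -1}" for J
  define tB where "tB J = {b\<in>B. b \<bullet> z J = R}" for J
  have zJ: "z J \<in> S" "i \<in> J \<Longrightarrow> v i \<bullet> z J \<le> -1" "b \<in> B \<Longrightarrow> b \<bullet> z J \<le> R" if "J \<in> M" for J i b
    using z(1)[OF that] unfolding C_def by auto
  have move: "\<exists>t>0. z J + t *\<^sub>R h \<in> C J"
    if J: "J \<in> M" and h: "h \<in> S" "\<And>i. i \<in> tI J \<Longrightarrow> v i \<bullet> h \<le> 0" "\<And>b. b \<in> tB J \<Longrightarrow> b \<bullet> h \<le> 0" for J h
  proof -
    have "\<forall>\<^sub>F t in at_right 0. \<forall>i\<in>J. v i \<bullet> z J + t * (v i \<bullet> h) \<le> -1"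
      using M(3)[OF J] zJ(2)[OF J] h(2) unfolding tI_def
      by (intro eventually_ball_finite ballI eventually_affine_le) auto
    moreover have "\<forall>\<^sub>F t in at_right 0. \<forall>b\<in>B. b \<bullet> z J + t * (b \<bullet> h) \<le> R"
      using finB zJ(3)[OF J] h(3) unfolding tB_def
      by (intro eventually_ball_finite ballI eventually_affine_le) auto
    moreover have "\<forall>\<^sub>F t in at_right (0::real). 0 < t" by (rule eventually_at_right_less)
    ultimately have "\<forall>\<^sub>F t in at_right 0. 0 < t \<and> z J + t *\<^sub>R h \<in> C J"
      by eventually_elim
        (use zJ(1)[OF J] h(1) S in \<open>auto simp: C_def inner_add_right subspace_add subspace_scale\<close>)
    then show ?thesis using eventually_happens[of _ "at_right (0::real)"] by (auto simp: trivial_limit_at_right_real)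
  qed
  have sep: "\<exists>b\<in>B. b \<bullet> h \<noteq> 0" if "h \<in> S" "h \<noteq> 0" for h
  proof (rule ccontr)
    assume "\<not> ?thesis"
    then have "(\<Sum>b\<in>B. (h \<bullet> b) *\<^sub>R b) = 0" by (intro sum.neutral) (auto simp: inner_commute)
    then show False using orthonormal_basis_expand[OF B0(2,3) _ finB, of h] that B0(6) by simp
  qed
  \<comment> \<open>A negative value would make \<open>z J\<close> a witness for the larger set
    \<open>insert i J\<close>. The gap between \<open>-1\<close> inside \<open>J\<close> and
    \<open>0\<close> outside lets \<open>z J\<close> determine \<open>J\<close>.\<close>
  have outside: "v i \<bullet> z J \<ge> 0" if J: "J \<in> M" and i: "i \<in> I" "i \<notin> J" for J i
  proof (rule ccontr)
    assume "\<not> ?thesis"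
    then have "feasible S v (insert i J)" unfolding feasible_def
      using zJ(1)[OF J] zJ(2)[OF J] by (intro bexI[of _ "z J"]) force+
    then show False using max_feasibleD(3)[of J S v I i] i J unfolding M_def by auto
  qed
  \<comment> \<open>Moving from \<open>z J\<close> away from \<open>z J'\<close> stays feasible for \<open>J\<close>, so by strict convexity \<open>z J'\<close> has the larger value.\<close>
  have lt: "\<phi> (z J) < \<phi> (z J')"
    if J: "J \<in> M" "J' \<in> M" and Y: "Y \<subseteq> I" "Y \<inter> J = tI J" "Y \<inter> J' = tI J'" "tB J = tB J'" and ne: "z J \<noteq> z J'" for J J' Y
  proof -
    define h where "h = z J - z J'"
    have hS: "h \<in> S" unfolding h_def using zJ(1) J S by (simp add: subspace_diff)
    \<comment> \<open>The value at \<open>z J\<close> is \<open>-1\<close>, so it suffices that the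
      value at \<open>z J'\<close> is at least \<open>-1\<close>: for indices in \<open>J'\<close>,
      membership in \<open>Y\<close> forces tightness there, and outside \<open>J'\<close> the value
      is nonnegative.\<close>
    have h1: "v i \<bullet> h \<le> 0" if i: "i \<in> tI J" for i
    proof -
      have "i \<in> Y" "i \<in> I" using i Y by auto
      then have "v i \<bullet> z J' \<ge> -1"
      proof (cases "i \<in> J'")
        case True
        then have "i \<in> tI J'" using Y \<open>i \<in> Y\<close> by blast
        then show ?thesis unfolding tI_def by auto
      next
        case False
        then show ?thesis using outside[OF J(2) \<open>i \<in> I\<close>] by force
      qed
      then show ?thesis using i unfolding h_def tI_def by (auto simp: inner_diff_right)
    qed
    have h2: "b \<bullet> h \<le> 0" if b: "b \<in> tB J" for b
    proof -
      have "b \<in> tB J'" using b Y(4) by simp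
      then show ?thesis using b unfolding h_def tB_def by (simp add: inner_diff_right)
    qed
    obtain t where t: "t > 0" "z J + t *\<^sub>R h \<in> C J" using move[OF J(1) hS h1 h2] by auto
    obtain b where b: "b \<in> B" "b \<bullet> h \<noteq> 0" using sep[OF hS] ne unfolding h_def by auto
    have "(1 + t) * \<phi> (z J) < \<phi> (z J + t *\<^sub>R h) + t * \<phi> (z J')"
      using exp_sum_strictly_convex[OF finB t(1) b(1), of "\<lambda>b. b \<bullet> h" "\<lambda>b. b \<bullet> z J"] b(2)
      unfolding \<phi>_def by (simp add: inner_add_right h_def inner_diff_right)
    also have "\<dots> \<le> \<phi> (z J) + t * \<phi> (z J')" using z(2)[OF J(1) t(2)] by simp
    finally have "t * \<phi> (z J) < t * \<phi> (z J')" by (simp add: algebra_simps)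
    then show ?thesis using t(1) by simp
  qed
  have J_eq: "J = {i\<in>I. v i \<bullet> z J \<le> -1}" if "J \<in> M" for J
    using M(1)[OF that] zJ(2)[OF that] outside[OF that] by force
  define E where "E J = {Y. Y \<subseteq> I \<and> Y \<inter> J = tI J} \<times> {tB J}" for J
  have disj: "E J \<inter> E J' = {}" if J: "J \<in> M" "J' \<in> M" "J \<noteq> J'" for J J'
  proof (rule ccontr)
    assume "\<not> ?thesis"
    then obtain Y where Y: "Y \<subseteq> I" "Y \<inter> J = tI J" "Y \<inter> J' = tI J'" "tB J = tB J'" unfolding E_def by auto
    have "z J \<noteq> z J'" using J_eq[OF J(1)] J_eq[OF J(2)] J(3) by metis
    then show False using lt[OF J(1,2) Y] lt[OF J(2,1) Y(1,3,2) Y(4)[symmetric]] by auto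
  qed
  have cardE: "card (E J) = 2 ^ (card I - card J)" if J: "J \<in> M" for J
  proof -
    have "{Y. Y \<subseteq> I \<and> Y \<inter> J = tI J} = (\<lambda>Z. Z \<union> tI J) ` Pow (I - J)"
    proof (intro equalityI subsetI)
      fix Y assume "Y \<in> {Y. Y \<subseteq> I \<and> Y \<inter> J = tI J}"
      then have "Y = (Y - J) \<union> tI J" "Y - J \<in> Pow (I - J)" by auto
      then show "Y \<in> (\<lambda>Z. Z \<union> tI J) ` Pow (I - J)" by (rule image_eqI)
    next
      fix Y assume "Y \<in> (\<lambda>Z. Z \<union> tI J) ` Pow (I - J)"
      then show "Y \<in> {Y. Y \<subseteq> I \<and> Y \<inter> J = tI J}" using M(1)[OF J] unfolding tI_def by auto
    qed
    moreover have "inj_on (\<lambda>Z. Z \<union> tI J) (Pow (I - J))"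
      unfolding tI_def by (intro inj_onI) blast
    ultimately have "card {Y. Y \<subseteq> I \<and> Y \<inter> J = tI J} = 2 ^ card (I - J)"
      using I by (simp add: card_image card_Pow)
    then show ?thesis unfolding E_def using card_Diff_subset[OF M(3,1)[OF J]] by (simp add: card_cartesian_product)
  qed
  have EP: "(\<Union>J\<in>M. E J) \<subseteq> Pow I \<times> Pow B" unfolding E_def tB_def by auto
  have finP: "finite (Pow I \<times> Pow B)" using I finB by simp
  have cP: "card (Pow I \<times> Pow B) = 2 ^ card I * 2 ^ dim S"
    using I finB B0(5) by (simp add: card_cartesian_product card_Pow)
  have sum_eq: "2 ^ card I * (\<Sum>J\<in>M. (1/2) ^ card J) = real (card (\<Union>J\<in>M. E J))"
  proof -
    have "card (\<Union>J\<in>M. E J) = (\<Sum>J\<in>M. card (E J))"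
      by (rule card_UN_disjoint) (use finM disj finite_subset[OF _ finP] EP in \<open>auto simp: UN_subset_iff\<close>)
    then have "real (card (\<Union>J\<in>M. E J)) = (\<Sum>J\<in>M. 2 ^ (card I - card J))"
      by (simp add: cardE)
    also have "\<dots> = (\<Sum>J\<in>M. 2 ^ card I * (1/2) ^ card J)"
      by (intro sum.cong refl) (use M(1) I in \<open>auto simp: power_diff card_mono power_one_over divide_simps\<close>)
    finally show ?thesis by (simp add: sum_distrib_left)
  qed
  have "card (\<Union>J\<in>M. E J) \<le> 2 ^ card I * 2 ^ dim S"
    using card_mono[OF finP EP] cP by simp
  then have "real (card (\<Union>J\<in>M. E J)) \<le> real (2 ^ card I * 2 ^ dim S)" by (rule of_nat_mono)
  then have "2 ^ card I * (\<Sum>J\<in>M. (1/2) ^ card J) \<le> 2 ^ card I * (2::real) ^ dim S"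
    unfolding sum_eq by simp
  then show "(\<Sum>J\<in>max_feasible S v I. (1/2) ^ card J) \<le> (2::real) ^ dim S" unfolding M_def by simp
  assume dS: "0 < dim S"
  have "(\<Union>J\<in>M. E J) \<subset> Pow I \<times> Pow B"
  proof -
    have "({}, {}) \<notin> E J" if J: "J \<in> M" for J
    proof
      assume "({}, {}) \<in> E J"
      then have e: "tI J = {}" "tB J = {}" unfolding E_def by auto
      have "B \<noteq> {}" using dS unfolding B0(5)[symmetric] by auto
      define h where "h = (\<Sum>b\<in>B. b)"
      have hb: "b \<bullet> h = 1" if "b \<in> B" for b
      proof -
        have "b \<bullet> h = (\<Sum>c\<in>B. if c = b then 1 else 0)"
          unfolding h_def inner_sum_right
          by (intro sum.cong refl) (use that B0(2,3) in \<open>auto simp: pairwise_def orthogonal_def norm_eq_1\<close>)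
        then show ?thesis using that finB by simp
      qed
      have "h \<in> S" unfolding h_def using B0(1) S by (intro subspace_sum) auto
      then obtain t where t: "t > 0" "z J + t *\<^sub>R h \<in> C J" using move[OF J, of h] e by auto
      have "\<phi> (z J) < \<phi> (z J + t *\<^sub>R h)" unfolding \<phi>_def
      proof (rule sum_strict_mono[OF finB \<open>B \<noteq> {}\<close>])
        fix b assume "b \<in> B"
        then have "b \<bullet> z J < b \<bullet> (z J + t *\<^sub>R h)" using hb t(1) by (simp add: inner_add_right)
        then show "b \<bullet> z J + exp (b \<bullet> z J) < b \<bullet> (z J + t *\<^sub>R h) + exp (b \<bullet> (z J + t *\<^sub>R h))"
          using exp_less_cancel_iff add_strict_mono by metis
      qed
      then show False using z(2)[OF J t(2)] by simp
    qed
    then show ?thesis using EP by blast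
  qed
  then have "card (\<Union>J\<in>M. E J) < 2 ^ card I * 2 ^ dim S"
    using psubset_card_mono[OF finP] cP by metis
  then have "real (card (\<Union>J\<in>M. E J)) < real (2 ^ card I * 2 ^ dim S)" by (rule of_nat_less_iff[THEN iffD2])
  then have "2 ^ card I * (\<Sum>J\<in>M. (1/2) ^ card J) < 2 ^ card I * (2::real) ^ dim S"
    unfolding sum_eq by simp
  then show "(\<Sum>J\<in>max_feasible S v I. (1/2) ^ card J) < (2::real) ^ dim S" unfolding M_def by simp
qed

section \<open>Contraction, deletion and merging\<close>

text \<open>
  \<open>M\<close> marks the indices that arose by merging a pair. A maximal set containing the merged index comes
  from one maximal set (containing the pair), one avoiding it comes from two (containing either
  member), hence the relative factor \<open>1/2\<close>.
\<close>

definition total_weight :: "'a::euclidean_space set \<Rightarrow> ('i \<Rightarrow> 'a) \<Rightarrow> 'i set \<Rightarrow> 'i set \<Rightarrow> real" where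
  "total_weight S v I M = (\<Sum>J\<in>max_feasible S v I. (1/2) ^ card (M \<inter> J))"

text \<open>For finite \<open>I\<close> this is, by Stiemke's alternative, a linear relation with
  positive coefficients among the restrictions of the \<open>v i\<close> to \<open>S\<close>.
  Vanishing on \<open>I\<close> is demanded instead of \<open>u = 0\<close> because deletion can
  leave normals that no longer span.\<close>

definition balanced :: "'a::euclidean_space set \<Rightarrow> ('i \<Rightarrow> 'a) \<Rightarrow> 'i set \<Rightarrow> bool" where
  "balanced S v I \<longleftrightarrow> (\<forall>u\<in>S. (\<forall>i\<in>I. 0 \<le> v i \<bullet> u) \<longrightarrow> (\<forall>i\<in>I. v i \<bullet> u = 0))"

text \<open>The vector \<open>- u\<close> is a recession direction of the polyhedron left when the
  inequality of \<open>q\<close> is dropped, and it violates that inequality eventually.\<close>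

definition separator :: "'a::euclidean_space set \<Rightarrow> ('i \<Rightarrow> 'a) \<Rightarrow> 'i set \<Rightarrow> 'i \<Rightarrow> 'a \<Rightarrow> bool" where
  "separator S v I q u \<longleftrightarrow> u \<in> S \<and> v q \<bullet> u < 0 \<and> (\<forall>i\<in>I - {q}. 0 \<le> v i \<bullet> u)"

text \<open>The equality case: each witness \<open>u\<close> sees only the two members \<open>k\<close> and \<open>\<sigma> k\<close> of a pair.\<close>

definition paired :: "'a::euclidean_space set \<Rightarrow> ('i \<Rightarrow> 'a) \<Rightarrow> 'i set \<Rightarrow> 'i set \<Rightarrow> bool" where
  "paired S v I U \<longleftrightarrow> (\<exists>K \<sigma>. K \<subseteq> U \<and> bij_betw \<sigma> K (U - K) \<and> card K = dim S \<and>
     (\<forall>k\<in>K. \<exists>u\<in>S. v k \<bullet> u < 0 \<and> 0 < v (\<sigma> k) \<bullet> u \<and> (\<forall>i\<in>I - {k, \<sigma> k}. v i \<bullet> u = 0)))"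

section \<open>Hyperplane sections, contraction and deletion\<close>

lemma subspace_Int_hyperplane: "subspace S \<Longrightarrow> subspace (S \<inter> {x. a \<bullet> x = 0})"
  by (intro subspace_inter subspace_hyperplane)

lemma dim_Int_hyperplane:
  fixes S :: "'a::euclidean_space set"
  assumes S: "subspace S" and u: "u \<in> S" "a \<bullet> u \<noteq> 0"
  shows "dim S = Suc (dim (S \<inter> {x. a \<bullet> x = 0}))"
proof -
  let ?T = "S \<inter> {x. a \<bullet> x = 0}"
  have T: "subspace ?T" by (rule subspace_Int_hyperplane[OF S])
  have "S \<subseteq> span (insert u ?T)"
  proof
    fix x assume x: "x \<in> S"
    define c where "c = (a \<bullet> x) / (a \<bullet> u)"
    have "x - c *\<^sub>R u \<in> ?T"
      using S x u by (auto simp: subspace_diff subspace_scale inner_diff_right c_def)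
    then show "x \<in> span (insert u ?T)"
      by (metis diff_add_cancel span_add span_base span_scale insertI1 insertI2)
  qed
  moreover have "span (insert u ?T) \<subseteq> S"
    by (rule span_minimal) (use u S in auto)
  ultimately have "span (insert u ?T) = S" by auto
  then have "dim S = dim (insert u ?T)" using dim_span by metis
  moreover have "u \<notin> span ?T" using u(2) T by (simp add: span_eq_iff[THEN iffD2])
  ultimately show ?thesis using dim_insert[of u ?T] by (metis Suc_eq_plus1)
qed

text \<open>A witness negative on \<open>v q\<close> moves onto the hyperplane by subtracting a
  positive multiple of \<open>u\<close>, which raises none of the other normals. Conversely a small
  step along \<open>u\<close> makes \<open>v q\<close> negative and preserves finitely many strict
  inequalities. So feasibility together with \<open>q\<close> equals feasibility on the hyperplane,
  and maximality transfers.\<close>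

lemma max_feasible_contract:
  assumes S: "subspace S" and sep: "separator S v I q u" and J: "J \<in> max_feasible S v I" "q \<in> J"
    and I: "finite I"
  shows "J - {q} \<in> max_feasible (S \<inter> {x. v q \<bullet> x = 0}) v (I - {q})"
proof -
  note u = sep[unfolded separator_def]
  have JI: "J \<subseteq> I" using max_feasibleD(1)[OF J(1)] .
  have down: "feasible (S \<inter> {x. v q \<bullet> x = 0}) v X" if X: "X \<subseteq> I - {q}" and f: "feasible S v (insert q X)" for X
  proof -
    obtain w where w: "w \<in> S" "\<And>i. i \<in> insert q X \<Longrightarrow> v i \<bullet> w < 0" using f unfolding feasible_def by blast
    define t where "t = (v q \<bullet> w) / (v q \<bullet> u)"
    have t: "0 < t" unfolding t_def using u w(2)[of q] by (simp add: divide_neg_neg)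
    have "w - t *\<^sub>R u \<in> S \<inter> {x. v q \<bullet> x = 0}"
      using S w(1) u by (auto simp: subspace_diff subspace_scale inner_diff_right t_def)
    moreover have "v i \<bullet> (w - t *\<^sub>R u) < 0" if "i \<in> X" for i
    proof -
      have "0 \<le> v i \<bullet> u" using u that X by auto
      then have "0 \<le> t * (v i \<bullet> u)" using t by simp
      then show ?thesis using w(2)[of i] that by (simp add: inner_diff_right)
    qed
    ultimately show ?thesis unfolding feasible_def by blast
  qed
  have up: "feasible S v (insert q X)" if X: "X \<subseteq> I - {q}" and f: "feasible (S \<inter> {x. v q \<bullet> x = 0}) v X" for X
  proof -
    obtain w where w: "w \<in> S" "v q \<bullet> w = 0" "\<And>i. i \<in> X \<Longrightarrow> v i \<bullet> w < 0" using f unfolding feasible_def by auto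
    have finX: "finite X" using X I finite_subset by blast
    have "\<forall>\<^sub>F t in at_right (0::real). \<forall>i\<in>X. v i \<bullet> w + t * (v i \<bullet> u) < 0"
    proof (intro eventually_ball_finite[OF finX] ballI)
      fix i assume i: "i \<in> X"
      have "((\<lambda>t. v i \<bullet> w + t * (v i \<bullet> u)) \<longlongrightarrow> v i \<bullet> w + 0 * (v i \<bullet> u)) (at_right 0)"
        by (intro tendsto_intros)
      then show "\<forall>\<^sub>F t in at_right (0::real). v i \<bullet> w + t * (v i \<bullet> u) < 0"
        by (rule order_tendstoD) (use w(3)[OF i] in simp)
    qed
    then obtain t :: real where t: "0 < t" "\<forall>i\<in>X. v i \<bullet> w + t * (v i \<bullet> u) < 0"
      using eventually_happens[OF eventually_conj[OF eventually_at_right_less[of "0::real"]]]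
      by (auto simp: trivial_limit_at_right_real)
    have "w + t *\<^sub>R u \<in> S" using S w(1) u by (simp add: subspace_add subspace_scale)
    moreover have "v i \<bullet> (w + t *\<^sub>R u) < 0" if "i \<in> insert q X" for i
      using that t w(2) u by (auto simp: inner_add_right mult_pos_neg)
    ultimately show ?thesis unfolding feasible_def by blast
  qed
  show ?thesis
    unfolding max_feasible_def
  proof (intro CollectI conjI ballI)
    show "J - {q} \<subseteq> I - {q}" using JI by auto
    show "feasible (S \<inter> {x. v q \<bullet> x = 0}) v (J - {q})"
      by (rule down) (use JI max_feasibleD(2)[OF J(1)] J(2) in \<open>auto simp: insert_absorb\<close>)
    fix i assume i: "i \<in> I - {q} - (J - {q})"
    show "\<not> feasible (S \<inter> {x. v q \<bullet> x = 0}) v (insert i (J - {q}))"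
    proof
      assume "feasible (S \<inter> {x. v q \<bullet> x = 0}) v (insert i (J - {q}))"
      then have "feasible S v (insert q (insert i (J - {q})))" by (rule up[rotated]) (use i JI in auto)
      moreover have "insert q (insert i (J - {q})) = insert i J" using J(2) by auto
      ultimately show False using max_feasibleD(3)[OF J(1), of i] i by auto
    qed
  qed
qed

text \<open>A long step along \<open>- u\<close> makes all of \<open>B\<close> negative and raises
  no normal other than \<open>v q\<close>; a maximal set avoiding \<open>q\<close> therefore absorbs
  \<open>B\<close>. The normals that remain vanish on \<open>u\<close>, so their witnesses can be
  projected along \<open>u\<close>.\<close>

lemma max_feasible_delete:
  assumes S: "subspace S" and I: "finite I" and sep: "separator S v I q u"
    and J: "J \<in> max_feasible S v I" "q \<notin> J" and B: "B = {i\<in>I - {q}. 0 < v i \<bullet> u}"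
  shows "B \<subseteq> J" and "J - B \<in> max_feasible (S \<inter> {x. u \<bullet> x = 0}) v (I - {q} - B)"
proof -
  note u = sep[unfolded separator_def]
  have JI: "J \<subseteq> I" using max_feasibleD(1)[OF J(1)] .
  have add: "feasible S v (X \<union> B)" if X: "X \<subseteq> I - {q}" and f: "feasible S v X" for X
  proof -
    obtain w where w: "w \<in> S" "\<And>i. i \<in> X \<Longrightarrow> v i \<bullet> w < 0" using f unfolding feasible_def by blast
    have finB: "finite B" using B I by auto
    define t where "t = (\<Sum>i\<in>B. (\<bar>v i \<bullet> w\<bar> + 1) / (v i \<bullet> u))"
    have t0: "0 \<le> t" unfolding t_def by (intro sum_nonneg) (auto simp: B)
    have "w - t *\<^sub>R u \<in> S" using S w(1) u by (simp add: subspace_diff subspace_scale)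
    moreover have "v i \<bullet> (w - t *\<^sub>R u) < 0" if i: "i \<in> X \<union> B" for i
    proof (cases "i \<in> B")
      case True
      then have p: "0 < v i \<bullet> u" by (simp add: B)
      have "(\<bar>v i \<bullet> w\<bar> + 1) / (v i \<bullet> u) \<le> t" unfolding t_def
        by (rule member_le_sum[OF True _ finB]) (auto simp: B)
      then have "\<bar>v i \<bullet> w\<bar> + 1 \<le> t * (v i \<bullet> u)" using p by (simp add: field_simps)
      then show ?thesis by (simp add: inner_diff_right)
    next
      case False
      then have "i \<in> X" using i by auto
      then have "0 \<le> v i \<bullet> u" using u X by auto
      then have "0 \<le> t * (v i \<bullet> u)" using t0 by simp
      then show ?thesis using w(2)[OF \<open>i \<in> X\<close>] by (simp add: inner_diff_right)
    qed
    ultimately show ?thesis unfolding feasible_def by blast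
  qed
  show BJ: "B \<subseteq> J"
  proof
    fix i assume i: "i \<in> B"
    have "feasible S v (J \<union> B)" by (rule add) (use JI J(2) max_feasibleD(2)[OF J(1)] in auto)
    then have "feasible S v (insert i J)" by (rule feasible_mono) (use i in auto)
    then show "i \<in> J" using max_feasibleD(3)[OF J(1)] i B by auto
  qed
  have zero: "v i \<bullet> u = 0" if "i \<in> I - {q} - B" for i using that u unfolding B by force
  have proj: "feasible (S \<inter> {x. u \<bullet> x = 0}) v X" if X: "X \<subseteq> I - {q} - B" and f: "feasible S v X" for X
  proof -
    obtain w where w: "w \<in> S" "\<And>i. i \<in> X \<Longrightarrow> v i \<bullet> w < 0" using f unfolding feasible_def by blast
    define t where "t = (u \<bullet> w) / (u \<bullet> u)"
    have "u \<noteq> 0" using u by auto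
    then have "w - t *\<^sub>R u \<in> S \<inter> {x. u \<bullet> x = 0}"
      using S w(1) u by (auto simp: subspace_diff subspace_scale inner_diff_right t_def)
    moreover have "v i \<bullet> (w - t *\<^sub>R u) < 0" if "i \<in> X" for i
      using w(2)[OF that] zero[OF subsetD[OF X that]] by (simp add: inner_diff_right)
    ultimately show ?thesis unfolding feasible_def by blast
  qed
  show "J - B \<in> max_feasible (S \<inter> {x. u \<bullet> x = 0}) v (I - {q} - B)"
    unfolding max_feasible_def
  proof (intro CollectI conjI ballI)
    show "J - B \<subseteq> I - {q} - B" using JI J(2) by auto
    show "feasible (S \<inter> {x. u \<bullet> x = 0}) v (J - B)"
      by (rule proj) (use JI J(2) feasible_mono[OF max_feasibleD(2)[OF J(1)]] in auto)
    fix i assume i: "i \<in> I - {q} - B - (J - B)"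
    show "\<not> feasible (S \<inter> {x. u \<bullet> x = 0}) v (insert i (J - B))"
    proof
      assume "feasible (S \<inter> {x. u \<bullet> x = 0}) v (insert i (J - B))"
      then have "feasible S v (insert i (J - B))" unfolding feasible_def by auto
      then have "feasible S v (insert i (J - B) \<union> B)" by (rule add[rotated]) (use i JI J(2) in auto)
      then have "feasible S v (insert i J)" by (rule feasible_mono) (use BJ in auto)
      then show False using max_feasibleD(3)[OF J(1), of i] i by auto
    qed
  qed
qed

lemma sum_le_sum_inj:
  fixes g :: "'b \<Rightarrow> real"
  assumes "finite B" "inj_on f A" "f ` A \<subseteq> B" "\<And>a. a \<in> A \<Longrightarrow> g a \<le> h (f a)" "\<And>b. b \<in> B \<Longrightarrow> 0 \<le> h b"
  shows "sum g A \<le> sum h B"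
proof -
  have "sum g A \<le> (\<Sum>a\<in>A. h (f a))" by (rule sum_mono) (rule assms(4))
  also have "\<dots> = sum h (f ` A)" using assms(2) by (simp add: sum.reindex)
  also have "\<dots> \<le> sum h B" by (rule sum_mono2) (use assms in auto)
  finally show ?thesis .
qed

lemma sum_contract_le:
  assumes S: "subspace S" and I: "finite I" and sep: "separator S v I q u" and q: "q \<notin> M"
  shows "(\<Sum>J | J \<in> max_feasible S v I \<and> q \<in> J. (1/2) ^ card (M \<inter> J))
    \<le> total_weight (S \<inter> {x. v q \<bullet> x = 0}) v (I - {q}) M"
  unfolding total_weight_def
proof (rule sum_le_sum_inj[where f = "\<lambda>J. J - {q}"])
  show "inj_on (\<lambda>J. J - {q}) {J. J \<in> max_feasible S v I \<and> q \<in> J}"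
    by (rule inj_onI) (metis (mono_tags, lifting) insert_Diff mem_Collect_eq)
  show "(1/2::real) ^ card (M \<inter> J) \<le> (1/2) ^ card (M \<inter> (J - {q}))" for J
    using q by (metis Diff_insert_absorb Int_Diff Diff_Int_distrib order_refl Int_insert_right_if0 Diff_empty Diff_insert0 IntD1)
qed (use I max_feasible_contract[OF S sep _ _ I] in auto)

text \<open>All sets on the left contain \<open>B\<close>, so removing it is injective and the marks
  in \<open>B\<close> contribute one common factor.\<close>

lemma sum_delete_le:
  assumes S: "subspace S" and I: "finite I" "M \<subseteq> I" and sep: "separator S v I q u"
    and B: "B = {i\<in>I - {q}. 0 < v i \<bullet> u}"
  shows "(\<Sum>J | J \<in> max_feasible S v I \<and> q \<notin> J. (1/2) ^ card (M \<inter> J))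
    \<le> (1/2) ^ card (M \<inter> B) * total_weight (S \<inter> {x. u \<bullet> x = 0}) v (I - {q} - B) (M - B)"
  unfolding total_weight_def sum_distrib_left
proof (rule sum_le_sum_inj[where f = "\<lambda>J. J - B"])
  show "inj_on (\<lambda>J. J - B) {J. J \<in> max_feasible S v I \<and> q \<notin> J}"
    using max_feasible_delete(1)[OF S I(1) sep _ _ B] by (intro inj_onI) blast
  show "(1/2::real) ^ card (M \<inter> J) \<le> (1/2) ^ card (M \<inter> B) * (1/2) ^ card ((M - B) \<inter> (J - B))"
    if "J \<in> {J. J \<in> max_feasible S v I \<and> q \<notin> J}" for J
  proof -
    have "B \<subseteq> J" using max_feasible_delete(1)[OF S I(1) sep _ _ B] that by blast
    then have "M \<inter> J = (M \<inter> B) \<union> ((M - B) \<inter> (J - B))" by auto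
    moreover have "finite M" using I finite_subset by auto
    ultimately have "card (M \<inter> J) = card (M \<inter> B) + card ((M - B) \<inter> (J - B))"
      by (metis (no_types, lifting) card_Un_disjoint finite_Int Diff_disjoint Int_assoc Int_left_commute Int_empty_right finite_Diff)
    then show ?thesis by (simp add: power_add)
  qed
qed (use I max_feasible_delete(2)[OF S I(1) sep _ _ B] in auto)

section \<open>Merging two normals along a direction that sees only them\<close>

context
  fixes S :: "'a::euclidean_space set" and v :: "'i \<Rightarrow> 'a" and I p q u \<alpha> \<beta>
  assumes S: "subspace S" and I: "finite I" and pq: "p \<in> I" "q \<in> I" "p \<noteq> q"
    and u: "u \<in> S" "v q \<bullet> u = - \<alpha>" "v p \<bullet> u = \<beta>" "0 < \<alpha>" "0 < \<beta>" "\<And>i. i \<in> I - {p, q} \<Longrightarrow> v i \<bullet> u = 0"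
begin

text \<open>Index \<open>p\<close> is reused for the merged normal. Its coefficients are those that
  annihilate \<open>u\<close>, since \<beta> * (- \<alpha>) + \<alpha> * \<beta> = 0, so orthogonal
  projection along \<open>u\<close> changes neither it nor the normals outside the pair.\<close>

lemma feasible_merge_down:
  assumes X: "X \<subseteq> I - {p, q}" and f: "feasible S v X"
  shows "feasible (S \<inter> {x. u \<bullet> x = 0}) (v(p := \<beta> *\<^sub>R v q + \<alpha> *\<^sub>R v p)) X"
    and "feasible S v (insert p (insert q X)) \<Longrightarrow>
      feasible (S \<inter> {x. u \<bullet> x = 0}) (v(p := \<beta> *\<^sub>R v q + \<alpha> *\<^sub>R v p)) (insert p X)"
proof -
  have proj: "\<exists>w'. w' \<in> S \<inter> {x. u \<bullet> x = 0} \<and> (\<forall>i\<in>X. v i \<bullet> w' = v i \<bullet> w) \<and>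
      (\<beta> *\<^sub>R v q + \<alpha> *\<^sub>R v p) \<bullet> w' = \<beta> * (v q \<bullet> w) + \<alpha> * (v p \<bullet> w)" if w: "w \<in> S" for w
  proof (intro exI conjI ballI)
    define t where "t = (u \<bullet> w) / (u \<bullet> u)"
    have "u \<noteq> 0" using u by auto
    then show "w - t *\<^sub>R u \<in> S \<inter> {x. u \<bullet> x = 0}"
      using S w(1) u(1) by (auto simp: subspace_diff subspace_scale inner_diff_right t_def)
    show "v i \<bullet> (w - t *\<^sub>R u) = v i \<bullet> w" if "i \<in> X" for i
      using u(6) that X by (auto simp: inner_diff_right)
    show "(\<beta> *\<^sub>R v q + \<alpha> *\<^sub>R v p) \<bullet> (w - t *\<^sub>R u) = \<beta> * (v q \<bullet> w) + \<alpha> * (v p \<bullet> w)"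
      using u(2,3) by (simp add: inner_diff_right inner_add_left algebra_simps)
  qed
  have "p \<notin> X" using X by auto
  show "feasible (S \<inter> {x. u \<bullet> x = 0}) (v(p := \<beta> *\<^sub>R v q + \<alpha> *\<^sub>R v p)) X"
  proof -
    obtain w where "w \<in> S" "\<forall>i\<in>X. v i \<bullet> w < 0" using f unfolding feasible_def by auto
    then obtain w' where w': "w' \<in> S \<inter> {x. u \<bullet> x = 0}" "\<forall>i\<in>X. v i \<bullet> w' < 0" using proj by metis
    then show ?thesis unfolding feasible_def using \<open>p \<notin> X\<close> by (intro bexI[OF _ w'(1)]) auto
  qed
  assume "feasible S v (insert p (insert q X))"
  then obtain w where w: "w \<in> S" "\<forall>i\<in>X. v i \<bullet> w < 0" "v p \<bullet> w < 0" "v q \<bullet> w < 0" unfolding feasible_def by auto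
  obtain w' where w': "w' \<in> S \<inter> {x. u \<bullet> x = 0}" "\<forall>i\<in>X. v i \<bullet> w' = v i \<bullet> w"
     "(\<beta> *\<^sub>R v q + \<alpha> *\<^sub>R v p) \<bullet> w' = \<beta> * (v q \<bullet> w) + \<alpha> * (v p \<bullet> w)" using proj[OF w(1)] by metis
  have "\<beta> * (v q \<bullet> w) + \<alpha> * (v p \<bullet> w) < 0" using w(3,4) u(4,5) by (simp add: add_neg_neg mult_pos_neg)
  then show "feasible (S \<inter> {x. u \<bullet> x = 0}) (v(p := \<beta> *\<^sub>R v q + \<alpha> *\<^sub>R v p)) (insert p X)"
    unfolding feasible_def using w(2) w' \<open>p \<notin> X\<close> by (intro bexI[OF _ w'(1)]) auto
qed

text \<open>A multiple of \<open>u\<close> moves \<open>v p\<close> and \<open>v q\<close> in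
  opposite directions and nothing else in \<open>X\<close>. A long step one way gains
  \<open>p\<close>, the other way \<open>q\<close>; an intermediate step gains both if the merged
  normal is negative.\<close>

lemma feasible_merge_up:
  assumes X: "X \<subseteq> I - {p, q}" and f: "feasible (S \<inter> {x. u \<bullet> x = 0}) (v(p := \<beta> *\<^sub>R v q + \<alpha> *\<^sub>R v p)) X"
  shows "feasible S v (insert p X)" and "feasible S v (insert q X)"
    and "feasible (S \<inter> {x. u \<bullet> x = 0}) (v(p := \<beta> *\<^sub>R v q + \<alpha> *\<^sub>R v p)) (insert p X) \<Longrightarrow>
      feasible S v (insert p (insert q X))"
proof -
  have "p \<notin> X" using X by auto
  have shift: "w + \<tau> *\<^sub>R u \<in> S" "v p \<bullet> (w + \<tau> *\<^sub>R u) = v p \<bullet> w + \<tau> * \<beta>" "v q \<bullet> (w + \<tau> *\<^sub>R u) = v q \<bullet> w - \<tau> * \<alpha>"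
    "\<And>i. i \<in> X \<Longrightarrow> v i \<bullet> (w + \<tau> *\<^sub>R u) = v i \<bullet> w" if "w \<in> S" for w \<tau>
    using that S u X by (auto simp: subspace_add subspace_scale inner_add_right)
  obtain w where w0: "w \<in> S" "\<forall>i\<in>X. (v(p := \<beta> *\<^sub>R v q + \<alpha> *\<^sub>R v p)) i \<bullet> w < 0"
    using f unfolding feasible_def by blast
  have w: "w \<in> S" "\<forall>i\<in>X. v i \<bullet> w < 0" using w0 \<open>p \<notin> X\<close> by (simp, metis fun_upd_other)
  show "feasible S v (insert p X)" unfolding feasible_def
  proof (intro bexI)
    show "\<forall>i\<in>insert p X. v i \<bullet> (w + (- (\<bar>v p \<bullet> w\<bar> + 1) / \<beta>) *\<^sub>R u) < 0"
    proof -
      have "(- (\<bar>v p \<bullet> w\<bar> + 1) / \<beta>) * \<beta> = - (\<bar>v p \<bullet> w\<bar> + 1)" using u(5) by simp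
      then have "v p \<bullet> (w + (- (\<bar>v p \<bullet> w\<bar> + 1) / \<beta>) *\<^sub>R u) < 0" unfolding shift(2)[OF w(1)] by linarith
      then show ?thesis using shift(4)[OF w(1)] w(2) by simp
    qed
  qed (rule shift[OF w(1)])
  show "feasible S v (insert q X)" unfolding feasible_def
  proof (intro bexI)
    show "\<forall>i\<in>insert q X. v i \<bullet> (w + ((\<bar>v q \<bullet> w\<bar> + 1) / \<alpha>) *\<^sub>R u) < 0"
    proof -
      have "((\<bar>v q \<bullet> w\<bar> + 1) / \<alpha>) * \<alpha> = \<bar>v q \<bullet> w\<bar> + 1" using u(4) by simp
      then have "v q \<bullet> (w + ((\<bar>v q \<bullet> w\<bar> + 1) / \<alpha>) *\<^sub>R u) < 0" unfolding shift(3)[OF w(1)] by linarith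
      then show ?thesis using shift(4)[OF w(1)] w(2) by simp
    qed
  qed (rule shift[OF w(1)])
  assume "feasible (S \<inter> {x. u \<bullet> x = 0}) (v(p := \<beta> *\<^sub>R v q + \<alpha> *\<^sub>R v p)) (insert p X)"
  then obtain y where y0: "y \<in> S" "\<forall>i\<in>insert p X. (v(p := \<beta> *\<^sub>R v q + \<alpha> *\<^sub>R v p)) i \<bullet> y < 0"
    unfolding feasible_def by blast
  have y: "y \<in> S" "\<forall>i\<in>X. v i \<bullet> y < 0" "\<beta> * (v q \<bullet> y) + \<alpha> * (v p \<bullet> y) < 0"
  proof -
    show "\<forall>i\<in>X. v i \<bullet> y < 0" using y0(2) \<open>p \<notin> X\<close> by (metis fun_upd_other insertCI)
    show "\<beta> * (v q \<bullet> y) + \<alpha> * (v p \<bullet> y) < 0" using y0(2) by (simp add: inner_add_left)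
  qed (rule y0)
  \<comment> \<open>Negativity of the merged normal says exactly that the interval of admissible
    \<tau> is nonempty.\<close>
  have "(v q \<bullet> y) / \<alpha> < - (v p \<bullet> y) / \<beta>" using y(3) u(4,5) by (simp add: field_simps)
  then obtain \<tau> where "(v q \<bullet> y) / \<alpha> < \<tau>" "\<tau> < - (v p \<bullet> y) / \<beta>" using dense by blast
  then have \<tau>: "v q \<bullet> y < \<tau> * \<alpha>" "v p \<bullet> y + \<tau> * \<beta> < 0" using u(4,5) by (simp_all add: field_simps)
  show "feasible S v (insert p (insert q X))" unfolding feasible_def
  proof (intro bexI)
    show "\<forall>i\<in>insert p (insert q X). v i \<bullet> (y + \<tau> *\<^sub>R u) < 0"
      using shift[OF y(1)] y(2) \<tau> by auto
  qed (rule shift[OF y(1)])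
qed

text \<open>A feasible set away from the pair can absorb either member, so a maximal set has at
  least one. It has both exactly when its trace together with the merged index is feasible on the
  hyperplane.\<close>

lemma max_feasible_merge:
  assumes J: "J \<in> max_feasible S v I"
  shows "p \<in> J \<or> q \<in> J"
    and "p \<in> J \<Longrightarrow> q \<in> J \<Longrightarrow>
      J - {q} \<in> max_feasible (S \<inter> {x. u \<bullet> x = 0}) (v(p := \<beta> *\<^sub>R v q + \<alpha> *\<^sub>R v p)) (I - {q})"
    and "p \<notin> J \<or> q \<notin> J \<Longrightarrow>
      J - {p, q} \<in> max_feasible (S \<inter> {x. u \<bullet> x = 0}) (v(p := \<beta> *\<^sub>R v q + \<alpha> *\<^sub>R v p)) (I - {q})"
proof -
  note JD = max_feasibleD[OF J]
  let ?S = "S \<inter> {x. u \<bullet> x = 0}" and ?v = "v(p := \<beta> *\<^sub>R v q + \<alpha> *\<^sub>R v p)"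
  let ?X = "J - {p, q}"
  have X: "?X \<subseteq> I - {p, q}" using JD(1) by auto
  have fX: "feasible S v ?X" by (rule feasible_mono[OF JD(2)]) auto
  have fX': "feasible ?S ?v ?X" by (rule feasible_merge_down(1)[OF X fX])
  show 1: "p \<in> J \<or> q \<in> J"
  proof (rule ccontr)
    assume n: "\<not> ?thesis"
    then have "?X = J" by auto
    then show False using feasible_merge_up(1)[OF X fX'] JD(3)[OF pq(1)] n by auto
  qed
  have ext: "feasible ?S ?v Y" "feasible S v (insert p Y)" "feasible S v (insert q Y)"
      "feasible S v (insert p (insert q Y))" if "feasible ?S ?v (insert p Y)" "Y \<subseteq> I - {p, q}" for Y
    using feasible_merge_up[OF that(2) feasible_mono[OF that(1)]] that(1) feasible_mono[OF that(1)] by auto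
  show "J - {q} \<in> max_feasible ?S ?v (I - {q})" if pJ: "p \<in> J" "q \<in> J"
    unfolding max_feasible_def
  proof (intro CollectI conjI ballI)
    have eq: "insert p (insert q ?X) = J" "insert p ?X = J - {q}" using pJ pq(3) by auto
    show "J - {q} \<subseteq> I - {q}" using JD(1) by auto
    show "feasible ?S ?v (J - {q})" using feasible_merge_down(2)[OF X fX] JD(2) unfolding eq by simp
    fix i assume i: "i \<in> I - {q} - (J - {q})"
    show "\<not> feasible ?S ?v (insert i (J - {q}))"
    proof
      assume "feasible ?S ?v (insert i (J - {q}))"
      moreover have e: "insert i (J - {q}) = insert p (insert i ?X)" using pJ pq(3) by auto
      ultimately have "feasible S v (insert p (insert q (insert i ?X)))"
        using ext(4)[of "insert i ?X"] i X pJ by auto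
      moreover have "insert p (insert q (insert i ?X)) = insert i J" using pJ by auto
      ultimately show False using JD(3)[of i] i by auto
    qed
  qed
  show "?X \<in> max_feasible ?S ?v (I - {q})" if nJ: "p \<notin> J \<or> q \<notin> J"
    unfolding max_feasible_def
  proof (intro CollectI conjI ballI)
    show "?X \<subseteq> I - {q}" using JD(1) by auto
    show "feasible ?S ?v ?X" by (rule fX')
    fix i assume i: "i \<in> I - {q} - ?X"
    show "\<not> feasible ?S ?v (insert i ?X)"
    proof
      assume f: "feasible ?S ?v (insert i ?X)"
      show False
      proof (cases "i = p")
        case True
        have "feasible S v (insert p (insert q ?X))" using ext(4)[of ?X] f X True by auto
        then have "feasible S v (insert p J)" "feasible S v (insert q J)"
          by (rule feasible_mono; use 1 in auto)+
        then show False using JD(3)[OF pq(1)] JD(3)[OF pq(2)] nJ by auto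
      next
        case False
        then have iX: "insert i ?X \<subseteq> I - {p, q}" "i \<notin> J" "i \<in> I" using i X by auto
        note up = feasible_merge_up(1,2)[OF iX(1) f]
        have "feasible S v (insert i J)"
        proof (cases "p \<in> J")
          case True
          then show ?thesis using feasible_mono[OF up(1), of "insert i J"] nJ by auto
        next
          case False
          then show ?thesis using feasible_mono[OF up(2), of "insert i J"] by auto
        qed
        then show False using JD(3)[of i] iX by auto
      qed
    qed
  qed
qed

lemma total_weight_merge_le:
  assumes M: "p \<notin> M" "q \<notin> M" "M \<subseteq> I"
  shows "total_weight S v I M \<le>
    2 * total_weight (S \<inter> {x. u \<bullet> x = 0}) (v(p := \<beta> *\<^sub>R v q + \<alpha> *\<^sub>R v p)) (I - {q}) (insert p M)"
proof -
  let ?S = "S \<inter> {x. u \<bullet> x = 0}" and ?v = "v(p := \<beta> *\<^sub>R v q + \<alpha> *\<^sub>R v p)"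
  define F where "F = max_feasible S v I"
  define F' where "F' = max_feasible ?S ?v (I - {q})"
  define w :: "'i set \<Rightarrow> real" where "w J = (1/2) ^ card (M \<inter> J)" for J
  define w' :: "'i set \<Rightarrow> real" where "w' J = (1/2) ^ card (insert p M \<inter> J)" for J
  have fin: "finite F" "finite F'" unfolding F_def F'_def using I by auto
  have finM: "finite M" using M(3) I finite_subset by auto
  have w'0: "0 \<le> w' J" for J unfolding w'_def by simp
  have w_eq: "w (J - {p, q}) = w J" for J
  proof -
    have "M \<inter> (J - {p, q}) = M \<inter> J" using M by auto
    then show ?thesis unfolding w_def by simp
  qed
  have w'1: "w' J = w J" if "p \<notin> J" for J using that unfolding w_def w'_def by simp
  have w'2: "2 * w' J = w J" if "p \<in> J" for J using that finM M(1) unfolding w_def w'_def by simp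
  have im: "J - {p, q} \<in> F'" if "J \<in> F" "p \<notin> J \<or> q \<notin> J" for J
    using max_feasible_merge(3) that unfolding F_def F'_def by blast
  have split: "F = {J\<in>F. p \<in> J \<and> q \<in> J} \<union> ({J\<in>F. p \<in> J \<and> q \<notin> J} \<union> {J\<in>F. p \<notin> J \<and> q \<in> J})"
    using max_feasible_merge(1) unfolding F_def by auto
  have "sum w F = sum w {J\<in>F. p \<in> J \<and> q \<in> J} + (sum w {J\<in>F. p \<in> J \<and> q \<notin> J} + sum w {J\<in>F. p \<notin> J \<and> q \<in> J})"
    using fin by (subst split, subst sum.union_disjoint) (auto intro!: sum.union_disjoint)
  also have "sum w {J\<in>F. p \<in> J \<and> q \<in> J} \<le> sum (\<lambda>J. 2 * w' J) {J\<in>F'. p \<in> J}"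
  proof (rule sum_le_sum_inj[where f = "\<lambda>J. J - {q}"])
    show "inj_on (\<lambda>J. J - {q}) {J \<in> F. p \<in> J \<and> q \<in> J}"
      by (rule inj_onI) (metis (mono_tags, lifting) insert_Diff mem_Collect_eq)
    show "w J \<le> 2 * w' (J - {q})" if "J \<in> {J \<in> F. p \<in> J \<and> q \<in> J}" for J
    proof -
      have "M \<inter> (J - {q}) = M \<inter> J" using M by auto
      then show ?thesis using w'2[of "J - {q}"] that pq(3) unfolding w_def by simp
    qed
  qed (use fin max_feasible_merge(2) pq(3) w'0 in \<open>auto simp: F_def F'_def\<close>)
  also have "sum w {J\<in>F. p \<in> J \<and> q \<notin> J} \<le> sum w' {J\<in>F'. p \<notin> J}"
  proof (rule sum_le_sum_inj[where f = "\<lambda>J. J - {p, q}"])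
    show "inj_on (\<lambda>J. J - {p, q}) {J \<in> F. p \<in> J \<and> q \<notin> J}" by (rule inj_onI) blast
    show "w J \<le> w' (J - {p, q})" for J using w'1[of "J - {p, q}"] w_eq by simp
    show "(\<lambda>J. J - {p, q}) ` {J \<in> F. p \<in> J \<and> q \<notin> J} \<subseteq> {J \<in> F'. p \<notin> J}" using im by blast
  qed (use fin im w'0 in auto)
  \<comment> \<open>The same target sum is used a second time; this doubling matches the factor 2
    that compensates the new mark in sets containing the pair.\<close>
  also have "sum w {J\<in>F. p \<notin> J \<and> q \<in> J} \<le> sum w' {J\<in>F'. p \<notin> J}"
  proof (rule sum_le_sum_inj[where f = "\<lambda>J. J - {p, q}"])
    show "inj_on (\<lambda>J. J - {p, q}) {J \<in> F. p \<notin> J \<and> q \<in> J}" by (rule inj_onI) blast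
    show "w J \<le> w' (J - {p, q})" for J using w'1[of "J - {p, q}"] w_eq by simp
    show "(\<lambda>J. J - {p, q}) ` {J \<in> F. p \<notin> J \<and> q \<in> J} \<subseteq> {J \<in> F'. p \<notin> J}" using im by blast
  qed (use fin im w'0 in auto)
  also have "sum (\<lambda>J. 2 * w' J) {J\<in>F'. p \<in> J} + (sum w' {J\<in>F'. p \<notin> J} + sum w' {J\<in>F'. p \<notin> J})
      = 2 * (sum w' {J\<in>F'. p \<in> J} + sum w' {J\<in>F'. p \<notin> J})"
    by (simp add: sum_distrib_left)
  also have "sum w' {J\<in>F'. p \<in> J} + sum w' {J\<in>F'. p \<notin> J} = sum w' F'"
    using fin(2) by (subst sum.union_disjoint[symmetric]) (auto intro!: sum.cong)
  finally show ?thesis unfolding total_weight_def F_def F'_def w_def w'_def by simp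
qed

end

section \<open>The induction on unmarked indices\<close>

text \<open>Normals orthogonal to \<open>u\<close> do not see the component of \<open>w\<close>
  along \<open>u\<close>, so it may be removed.\<close>

lemma separator_project:
  assumes S: "subspace S" and u: "u \<in> S" "u \<noteq> 0" and w: "separator S v I p w"
    and v': "\<And>i. i \<in> insert p I' \<Longrightarrow> v' i \<bullet> u = 0" "v' p \<bullet> w < 0" "\<And>i. i \<in> I' - {p} \<Longrightarrow> 0 \<le> v' i \<bullet> w"
  shows "\<exists>y. separator (S \<inter> {x. u \<bullet> x = 0}) v' I' p y"
proof -
  define y where "y = w - ((u \<bullet> w) / (u \<bullet> u)) *\<^sub>R u"
  have "y \<in> S \<inter> {x. u \<bullet> x = 0}"
    using S u w by (auto simp: separator_def subspace_diff subspace_scale inner_diff_right y_def)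
  moreover have "v' i \<bullet> y = v' i \<bullet> w" if "i \<in> insert p I'" for i
    using v'(1)[OF that] by (simp add: y_def inner_diff_right)
  ultimately show ?thesis using v'(2,3) unfolding separator_def by (intro exI[of _ y]) auto
qed

lemma paired_card:
  assumes "paired S v I U" "finite U"
  shows "card U = 2 * dim S"
proof -
  obtain K \<sigma> where K: "K \<subseteq> U" "bij_betw \<sigma> K (U - K)" "card K = dim S" using assms(1) unfolding paired_def by auto
  have "card (U - K) = dim S" using bij_betw_same_card[OF K(2)] K(3) by simp
  then show ?thesis using K(1,3) assms(2) card_Un_disjoint[of K "U - K"]
    by (simp add: Un_absorb1 finite_subset)
qed

text \<open>Contraction and deletion lower the number of unmarked indices by at least one, merging
  by two. The equality clause is part of the induction: it rules out equality in a split and is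
  extended by one pair in a merge.\<close>

lemma total_weight_le_aux:
  assumes S: "subspace S" and I: "finite I" "M \<subseteq> I" and bal: "balanced S v I"
    and irr: "\<And>q. q \<in> I - M \<Longrightarrow> \<exists>u. separator S v I q u"
  shows "total_weight S v I M \<le> 2 ^ dim S \<and> (total_weight S v I M = 2 ^ dim S \<longrightarrow> paired S v I (I - M))"
  using assms
proof (induction "card (I - M)" arbitrary: S v I M rule: less_induct)
  case less
  note S = \<open>subspace S\<close> and I = \<open>finite I\<close> \<open>M \<subseteq> I\<close> and bal = \<open>balanced S v I\<close> and irr = less.prems(5)
  note balD = bal[unfolded balanced_def, rule_format]
  show ?case
  proof (cases "I - M = {}")
    case True
    \<comment> \<open>Here the weight is the Kraft sum. Its strict form leaves equality only in
      dimension 0, where the empty pairing serves.\<close>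
    then have "M = I" using I by auto
    have "total_weight S v I M = (\<Sum>J\<in>max_feasible S v I. (1/2) ^ card J)"
      unfolding total_weight_def \<open>M = I\<close>
      by (intro sum.cong refl) (use max_feasibleD(1) in \<open>metis inf.absorb2\<close>)
    moreover have "paired S v I (I - M)" if "dim S = 0"
      unfolding paired_def True using that by (intro exI[of _ "{}"]) (auto simp: bij_betw_def)
    ultimately show ?thesis using sum_half_power_max_feasible[OF S I(1), of v]
      by (metis less_irrefl neq0_conv)
  next
    case False
    then obtain q where q: "q \<in> I" "q \<notin> M" by auto
    define pos where "pos u = {i\<in>I - {q}. 0 < v i \<bullet> u}" for u
    have pos_le: "card (pos u) \<le> card I" for u unfolding pos_def using I by (intro card_mono) auto
    obtain u0 where "separator S v I q u0" using irr q by auto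
    then obtain u where u: "separator S v I q u" "\<And>y. separator S v I q y \<Longrightarrow> card (pos y) \<le> card (pos u)"
      using ex_has_greatest_nat[of "separator S v I q" u0 "\<lambda>u. card (pos u)" "Suc (card I)"] pos_le by (auto simp: less_Suc_eq_le)
    \<comment> \<open>Maximality of the positive set is what keeps the deleted configuration balanced.\<close>
    note uD = u(1)[unfolded separator_def]
    have u0: "u \<noteq> 0" using uD by auto
    define C where "C = S \<inter> {x. v q \<bullet> x = 0}"
    define D where "D = S \<inter> {x. u \<bullet> x = 0}"
    have sub: "subspace C" "subspace D" unfolding C_def D_def using S by (simp_all add: subspace_Int_hyperplane)
    have dimC: "dim S = Suc (dim C)" unfolding C_def by (rule dim_Int_hyperplane[OF S, of u]) (use uD in auto)
    have dimD: "dim S = Suc (dim D)" unfolding D_def by (rule dim_Int_hyperplane[OF S, of u]) (use uD u0 in auto)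
    have CD: "dim C = dim D" using dimC dimD by simp
    have fin: "finite (I - M)" using I by simp
    show ?thesis
    proof (cases "\<forall>p\<in>I - {q} - M. \<exists>w. separator C v (I - {q}) p w")
      case True
      have IHC: "total_weight C v (I - {q}) M \<le> 2 ^ dim C \<and>
          (total_weight C v (I - {q}) M = 2 ^ dim C \<longrightarrow> paired C v (I - {q}) (I - {q} - M))"
      proof (rule less.hyps[OF _ sub(1)])
        show "card (I - {q} - M) < card (I - M)" using q fin by (intro psubset_card_mono) auto
        show "balanced C v (I - {q})" unfolding balanced_def
        proof (intro ballI impI)
          fix w i assume "w \<in> C" "\<forall>i\<in>I - {q}. 0 \<le> v i \<bullet> w" "i \<in> I - {q}"
          then show "v i \<bullet> w = 0" using balD[of w i] unfolding C_def by force
        qed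
      qed (use I q True in auto)
      define B where "B = pos u"
      have B: "B = {i\<in>I - {q}. 0 < v i \<bullet> u}" unfolding B_def pos_def ..
      have zero: "v i \<bullet> u = 0" if "i \<in> I - {q} - B" for i using that uD unfolding B by force
      have IHD: "total_weight D v (I - {q} - B) (M - B) \<le> 2 ^ dim D \<and>
          (total_weight D v (I - {q} - B) (M - B) = 2 ^ dim D \<longrightarrow> paired D v (I - {q} - B) (I - {q} - B - (M - B)))"
      proof (rule less.hyps[OF _ sub(2)])
        show "card (I - {q} - B - (M - B)) < card (I - M)" using q fin by (intro psubset_card_mono) auto
        show "balanced D v (I - {q} - B)" unfolding balanced_def
        proof (intro ballI impI, rule ccontr)
          fix w j assume w: "w \<in> D" "\<forall>i\<in>I - {q} - B. 0 \<le> v i \<bullet> w" and j: "j \<in> I - {q} - B" "v j \<bullet> w \<noteq> 0"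
          \<comment> \<open>With \<open>t\<close> this large, \<open>t *\<^sub>R u\<close> dominates
            \<open>w\<close> on \<open>q\<close> and \<open>B\<close>. Then
            \<open>w + t *\<^sub>R u\<close> separates \<open>q\<close> and is positive on
            \<open>B\<close> and also on \<open>j\<close>, against the choice of
            \<open>u\<close>.\<close>
          define t where "t = (\<Sum>i\<in>insert q B. (\<bar>v i \<bullet> w\<bar> + 1) / \<bar>v i \<bullet> u\<bar>)"
          have finB: "finite (insert q B)" using I unfolding B by auto
          have t: "\<bar>v i \<bullet> w\<bar> < t * \<bar>v i \<bullet> u\<bar>" if i: "i \<in> insert q B" for i
          proof -
            have p: "0 < \<bar>v i \<bullet> u\<bar>" using i uD unfolding B by auto
            have "(\<bar>v i \<bullet> w\<bar> + 1) / \<bar>v i \<bullet> u\<bar> \<le> t" unfolding t_def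
              by (rule member_le_sum[OF i _ finB]) auto
            then have "\<bar>v i \<bullet> w\<bar> + 1 \<le> t * \<bar>v i \<bullet> u\<bar>" using p by (simp add: field_simps)
            then show ?thesis by simp
          qed
          define y where "y = w + t *\<^sub>R u"
          have vy: "v i \<bullet> y = v i \<bullet> w + t * (v i \<bullet> u)" for i by (simp add: y_def inner_add_right)
          have posB: "0 < v i \<bullet> y" if "i \<in> B" for i using t[of i] that unfolding vy by (auto simp: B)
          have eqN: "v i \<bullet> y = v i \<bullet> w" if "i \<in> I - {q} - B" for i using zero[OF that] unfolding vy by simp
          have "v q \<bullet> y < 0" using t[of q] uD unfolding vy by auto
          moreover have "0 \<le> v i \<bullet> y" if "i \<in> I - {q}" for i
            using that posB[of i] eqN[of i] w(2) by (cases "i \<in> B") auto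
          moreover have "y \<in> S" using w(1) uD S unfolding y_def D_def by (simp add: subspace_add subspace_scale)
          ultimately have "separator S v I q y" unfolding separator_def by auto
          then have "card (pos y) \<le> card B" unfolding B_def by (rule u(2))
          moreover have "insert j B \<subseteq> pos y"
            using posB eqN[OF j(1)] w(2) j unfolding pos_def by (force simp: B)
          then have "card (insert j B) \<le> card (pos y)" by (rule card_mono[rotated]) (use I in \<open>simp add: pos_def\<close>)
          ultimately show False using j(1) finB by simp
        qed
        show "\<exists>w. separator D v (I - {q} - B) p w" if p: "p \<in> I - {q} - B - (M - B)" for p
        proof -
          obtain w where w: "separator S v I p w" using irr[of p] p by auto
          show ?thesis unfolding D_def
            by (rule separator_project[OF S _ u0 w]) (use uD zero p w in \<open>auto simp: separator_def\<close>)
        qed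
      qed (use I q in auto)
      define c where "c = card (M \<inter> B)"
      have split: "total_weight S v I M \<le> total_weight C v (I - {q}) M + (1/2) ^ c * total_weight D v (I - {q} - B) (M - B)"
      proof -
        have "total_weight S v I M = (\<Sum>J | J \<in> max_feasible S v I \<and> q \<in> J. (1/2) ^ card (M \<inter> J)) +
            (\<Sum>J | J \<in> max_feasible S v I \<and> q \<notin> J. (1/2) ^ card (M \<inter> J))"
          unfolding total_weight_def using I
          by (subst sum.union_disjoint[symmetric]) (auto intro!: sum.cong)
        then show ?thesis using sum_contract_le[OF S I(1) u(1) q(2)] sum_delete_le[OF S I u(1) B]
          unfolding C_def D_def c_def by linarith
      qed
      have half: "(1/2) ^ c * total_weight D v (I - {q} - B) (M - B) \<le> (1/2) ^ c * 2 ^ dim D"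
        using IHD by (intro mult_left_mono) auto
      have "(1/2::real) ^ c \<le> 1" by (rule power_le_one) auto
      then have halfle: "(1/2) ^ c * (2::real) ^ dim D \<le> 2 ^ dim D"
        using mult_right_mono[of "(1/2::real) ^ c" 1 "2 ^ dim D"] by simp
      have two: "(2::real) ^ dim S = 2 ^ dim C + 2 ^ dim D" using dimC CD by simp
      \<comment> \<open>Equality would make both parts paired with \<open>c = 0\<close>. Both then
        have the same number of unmarked indices, so nothing was deleted and \<open>B\<close> is
        empty; but then \<open>- u\<close> is nonnegative on all normals, and balance contradicts
        \<open>v q \<bullet> u < 0\<close>.\<close>
      have "total_weight S v I M \<noteq> 2 ^ dim S"
      proof
        assume eq: "total_weight S v I M = 2 ^ dim S"
        have eC: "total_weight C v (I - {q}) M = 2 ^ dim C"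
          and eD: "(1/2) ^ c * total_weight D v (I - {q} - B) (M - B) = 2 ^ dim D"
          using eq split half halfle two IHC by linarith+
        have "c = 0"
        proof (rule ccontr)
          assume "c \<noteq> 0"
          then have "(1/2::real) ^ c < 1" by (simp add: power_less_one_iff)
          then have "(1/2) ^ c * (2::real) ^ dim D < 2 ^ dim D"
            using mult_strict_right_mono[of "(1/2::real) ^ c" 1 "2 ^ dim D"] by simp
          then show False using eD half by linarith
        qed
        then have MB: "M \<inter> B = {}" unfolding c_def using I finite_subset by fastforce
        have "card (I - {q} - M) = 2 * dim C" using eC IHC I by (intro paired_card[of C v "I - {q}"]) auto
        moreover have "card (I - {q} - B - (M - B)) = 2 * dim D"
          using eD \<open>c = 0\<close> IHD I by (intro paired_card[of D v "I - {q} - B"]) auto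
        ultimately have ce: "card (I - {q} - B - (M - B)) = card (I - {q} - M)" using CD by simp
        have "I - {q} - B - (M - B) = I - {q} - M"
          by (rule card_subset_eq[OF _ _ ce]) (use I in auto)
        then have "B = {}" using MB unfolding B by blast
        then have "v i \<bullet> u = 0" if "i \<in> I - {q}" for i using zero that by auto
        then have "\<forall>i\<in>I. 0 \<le> v i \<bullet> (- u)" using uD by force
        then have "v q \<bullet> (- u) = 0" using balD[of "- u" q] q uD S by (simp add: subspace_neg)
        then show False using uD by simp
      qed
      then show ?thesis using split half halfle two IHC by linarith
    next
      case False
      then obtain p where p: "p \<in> I - {q} - M" and np: "\<And>w. \<not> separator C v (I - {q}) p w" by blast
      obtain w where w: "separator S v I p w" using irr[of p] p by auto
      note wD = w[unfolded separator_def]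
      define \<alpha> where "\<alpha> = - (v q \<bullet> u)"
      define \<beta> where "\<beta> = v p \<bullet> u"
      have \<alpha>: "0 < \<alpha>" unfolding \<alpha>_def using uD by simp
      \<comment> \<open>Chosen so that \<open>w + t *\<^sub>R u\<close> annihilates
        \<open>v q\<close>, that is, lies in \<open>C\<close>.\<close>
      define t where "t = (v q \<bullet> w) / \<alpha>"
      have t0: "0 \<le> t" unfolding t_def using wD q p \<alpha> by auto
      define y where "y = w + t *\<^sub>R u"
      have vy: "v i \<bullet> y = v i \<bullet> w + t * (v i \<bullet> u)" for i by (simp add: y_def inner_add_right)
      have yC: "y \<in> C" using wD uD S \<alpha> unfolding C_def
        by (auto simp: vy t_def \<alpha>_def) (simp add: y_def subspace_add subspace_scale)
      have ypos: "0 \<le> v i \<bullet> y" if "i \<in> I - {q} - {p}" for i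
        unfolding vy using that wD uD t0 by auto
      have "\<not> v p \<bullet> y < 0" using np[of y] yC ypos unfolding separator_def by blast
      then have "\<forall>i\<in>I. 0 \<le> v i \<bullet> y" using ypos yC unfolding C_def by force
      then have y0: "v i \<bullet> y = 0" if "i \<in> I" for i using balD[of y i] yC that unfolding C_def by blast
      have "v p \<bullet> w < 0" using wD by simp
      then have "0 < t * \<beta>" using y0[of p] p unfolding vy \<beta>_def by auto
      then have \<beta>: "0 < \<beta>" and t: "0 < t" using t0 by (simp_all add: zero_less_mult_iff)
      have others: "v i \<bullet> u = 0" if i: "i \<in> I - {p, q}" for i
      proof -
        have "0 \<le> v i \<bullet> w" "0 \<le> v i \<bullet> u" using wD uD i by auto
        moreover have "v i \<bullet> w + t * (v i \<bullet> u) = 0" using y0[of i] i unfolding vy by auto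
        ultimately have "t * (v i \<bullet> u) \<le> 0" by linarith
        then show ?thesis using t \<open>0 \<le> v i \<bullet> u\<close> by (simp add: mult_le_0_iff)
      qed
      define r where "r = \<beta> *\<^sub>R v q + \<alpha> *\<^sub>R v p"
      have ru: "r \<bullet> u = 0" unfolding r_def \<alpha>_def \<beta>_def by (simp add: inner_diff_left inner_add_left)
      have rx: "r \<bullet> x = \<beta> * (v q \<bullet> x) + \<alpha> * (v p \<bullet> x)" for x unfolding r_def by (simp add: inner_add_left)
      let ?v = "v(p := r)"
      have pq: "p \<in> I" "q \<in> I" "p \<noteq> q" using p q by auto
      have merge: "total_weight S v I M \<le> 2 * total_weight D ?v (I - {q}) (insert p M)"
        unfolding D_def r_def
        by (rule total_weight_merge_le[OF S I(1) pq])
          (use uD \<alpha> \<beta> others p q I in \<open>auto simp: \<alpha>_def \<beta>_def\<close>)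
      have IH: "total_weight D ?v (I - {q}) (insert p M) \<le> 2 ^ dim D \<and>
          (total_weight D ?v (I - {q}) (insert p M) = 2 ^ dim D \<longrightarrow> paired D ?v (I - {q}) (I - {q} - insert p M))"
      proof (rule less.hyps[OF _ sub(2)])
        show "card (I - {q} - insert p M) < card (I - M)" using q fin by (intro psubset_card_mono) auto
        show "balanced D ?v (I - {q})" unfolding balanced_def
        proof (intro ballI impI)
          fix x i assume x: "x \<in> D" "\<forall>i\<in>I - {q}. 0 \<le> ?v i \<bullet> x" and i: "i \<in> I - {q}"
          \<comment> \<open>The shift along \<open>u\<close> makes \<open>v p\<close> vanish and
            turns the sign of \<open>r \<bullet> x\<close> into that of
            \<open>v q \<bullet> z\<close>, so balance of the original normals applies to
            \<open>z\<close>.\<close>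
          define z where "z = x + (- (v p \<bullet> x) / \<beta>) *\<^sub>R u"
          have vz: "v i \<bullet> z = v i \<bullet> x + (- (v p \<bullet> x) / \<beta>) * (v i \<bullet> u)" for i
            by (simp add: z_def inner_diff_right)
          have zS: "z \<in> S" using x(1) uD S unfolding z_def D_def by (simp add: subspace_diff subspace_scale)
          have zp: "v p \<bullet> z = 0" unfolding vz using \<beta> by (simp add: \<beta>_def)
          have "v q \<bullet> z = (r \<bullet> x) / \<beta>" unfolding vz rx using \<beta> by (simp add: \<alpha>_def field_simps)
          moreover have "0 \<le> r \<bullet> x" using x(2) pq by (metis Diff_iff fun_upd_same singletonD)
          ultimately have zq: "0 \<le> v q \<bullet> z" "v q \<bullet> z = (r \<bullet> x) / \<beta>" using \<beta> by simp_all
          have zo: "v i \<bullet> z = v i \<bullet> x" if "i \<in> I - {p, q}" for i unfolding vz using others[OF that] by simp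
          have "\<forall>i\<in>I. 0 \<le> v i \<bullet> z"
          proof
            fix i assume iI: "i \<in> I"
            show "0 \<le> v i \<bullet> z"
            proof (cases "i = p \<or> i = q")
              case True
              then show ?thesis using zp zq by auto
            next
              case False
              then have "0 \<le> ?v i \<bullet> x" using x(2) iI by blast
              then show ?thesis using zo[of i] iI False by simp
            qed
          qed
          then have z0: "v i \<bullet> z = 0" if "i \<in> I" for i using balD[OF zS] that by blast
          show "?v i \<bullet> x = 0"
          proof (cases "i = p")
            case True
            then show ?thesis using z0[OF pq(2)] zq(2) \<beta> by simp
          next
            case False
            then show ?thesis using z0[of i] zo[of i] i by simp
          qed
        qed
        show "\<exists>w. separator D ?v (I - {q}) x w" if x: "x \<in> I - {q} - insert p M" for x
        proof -
          obtain y where y: "separator S v I x y" using irr[of x] x by auto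
          have "0 \<le> r \<bullet> y" unfolding rx using y x pq \<alpha> \<beta> by (auto simp: separator_def)
          then show ?thesis unfolding D_def
            by (intro separator_project[OF S _ u0 y]) (use uD others ru x y in \<open>auto simp: separator_def\<close>)
        qed
      qed (use I p q in auto)
      have two: "(2::real) ^ dim S = 2 * 2 ^ dim D" using dimD by simp
      have "paired S v I (I - M)" if eq: "total_weight S v I M = 2 ^ dim S"
      proof -
        have "total_weight D ?v (I - {q}) (insert p M) = 2 ^ dim D" using eq merge IH two by linarith
        then have "paired D ?v (I - {q}) (I - {q} - insert p M)" using IH by blast
        then obtain K \<sigma> where K: "K \<subseteq> I - {q} - insert p M" "bij_betw \<sigma> K (I - {q} - insert p M - K)" "card K = dim D"
          and Ku: "\<forall>k\<in>K. \<exists>u\<in>D. ?v k \<bullet> u < 0 \<and> 0 < ?v (\<sigma> k) \<bullet> u \<and> (\<forall>i\<in>I - {q} - {k, \<sigma> k}. ?v i \<bullet> u = 0)"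
          unfolding paired_def by auto
        have pK: "p \<notin> K" "q \<notin> K" using K(1) by auto
        have finK: "finite K" by (rule finite_subset[OF K(1)]) (use I in simp)
        have \<sigma>K: "\<sigma> k \<in> I - {q} - insert p M - K" if "k \<in> K" for k using K(2) that by (auto simp: bij_betw_def)
        show ?thesis unfolding paired_def
        proof (intro exI conjI ballI)
          \<comment> \<open>The merged indices form the new pair: \<open>p\<close> joins
            \<open>K\<close> with partner \<open>q\<close>, and \<open>- u\<close> is its
            witness.\<close>
          show "insert p K \<subseteq> I - M" using K(1) p by auto
          have "bij_betw (\<sigma>(p := q)) (insert p K) (insert q (I - {q} - insert p M - K))"
          proof -
            have "bij_betw (\<sigma>(p := q)) K (I - {q} - insert p M - K)"
              using K(2) pK by (subst bij_betw_cong[of K "\<sigma>(p := q)" \<sigma>]) auto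
            then show ?thesis using bij_betw_combine[of "\<sigma>(p := q)" "{p}" "{q}" K] by auto
          qed
          moreover have "insert q (I - {q} - insert p M - K) = I - M - insert p K" using q pK pq by auto
          ultimately show "bij_betw (\<sigma>(p := q)) (insert p K) (I - M - insert p K)" by simp
          show "card (insert p K) = dim S" using K(3) pK finK dimD by simp
          fix k assume k: "k \<in> insert p K"
          show "\<exists>u\<in>S. v k \<bullet> u < 0 \<and> 0 < v ((\<sigma>(p := q)) k) \<bullet> u \<and> (\<forall>i\<in>I - {k, (\<sigma>(p := q)) k}. v i \<bullet> u = 0)"
          proof (cases "k = p")
            case True
            then show ?thesis using uD S \<alpha> \<beta> others
              by (intro bexI[of _ "- u"]) (auto simp: \<alpha>_def \<beta>_def subspace_neg)
          next
            case False
            then have kK: "k \<in> K" using k by auto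
            then obtain x where x: "x \<in> D" "?v k \<bullet> x < 0" "0 < ?v (\<sigma> k) \<bullet> x" "\<forall>i\<in>I - {q} - {k, \<sigma> k}. ?v i \<bullet> x = 0"
              using Ku by auto
            have ne: "\<sigma> k \<noteq> p" "\<sigma> k \<noteq> q" "k \<noteq> q" "k \<in> I" "\<sigma> k \<in> I" using \<sigma>K[OF kK] kK K(1) by auto
            \<comment> \<open>The old witness is lifted by the same shift. Since the merged index
              belongs to no old pair, \<open>r \<bullet> x = 0\<close>, and so \<open>v q\<close>
              vanishes at \<open>z\<close> together with \<open>v p\<close>.\<close>
            define z where "z = x + (- (v p \<bullet> x) / \<beta>) *\<^sub>R u"
            have vz: "v i \<bullet> z = v i \<bullet> x + (- (v p \<bullet> x) / \<beta>) * (v i \<bullet> u)" for i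
              by (simp add: z_def inner_diff_right)
            have zS: "z \<in> S" using x(1) uD S unfolding z_def D_def by (simp add: subspace_diff subspace_scale)
            have zp: "v p \<bullet> z = 0" unfolding vz using \<beta> by (simp add: \<beta>_def)
            have "r \<bullet> x = 0" using x(4) pq(1,3) ne False by (metis DiffI fun_upd_same insertE singletonD)
            then have zq: "v q \<bullet> z = 0" unfolding vz using \<beta> rx[of x] by (simp add: \<alpha>_def field_simps)
            have zo: "v i \<bullet> z = v i \<bullet> x" if "i \<in> I - {p, q}" for i unfolding vz using others[OF that] by simp
            show ?thesis
            proof (intro bexI[OF _ zS] conjI ballI)
              show "v k \<bullet> z < 0" using zo[of k] ne False x(2) by auto
              show "0 < v ((\<sigma>(p := q)) k) \<bullet> z" using zo[of "\<sigma> k"] ne False x(3) by auto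
              fix i assume i: "i \<in> I - {k, (\<sigma>(p := q)) k}"
              show "v i \<bullet> z = 0"
              proof (cases "i = p \<or> i = q")
                case True
                then show ?thesis using zp zq by auto
              next
                case no: False
                then have "i \<in> I - {q} - {k, \<sigma> k}" using i False by auto
                then have "?v i \<bullet> x = 0" using x(4) by blast
                then show ?thesis using zo[of i] i no by auto
              qed
            qed
          qed
        qed
      qed
      then show ?thesis using merge IH two by linarith
    qed
  qed
qed

lemma total_weight_le:
  assumes "subspace S" "finite I" "M \<subseteq> I" "balanced S v I"
    and "\<And>q. q \<in> I - M \<Longrightarrow> \<exists>u. separator S v I q u"
  shows "total_weight S v I M \<le> 2 ^ dim S"
    and "total_weight S v I M = 2 ^ dim S \<Longrightarrow> paired S v I (I - M)"
  using total_weight_le_aux[OF assms] by auto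

section \<open>Illumination\<close>

text \<open>Without such a direction the sum of the positive parts of the
  \<open>v i \<bullet> u\<close> has a positive minimum on the unit sphere; by homogeneity this
  bounds the norm of every point of the polyhedron.\<close>

lemma unbounded_polyhedron_direction:
  fixes v :: "'i \<Rightarrow> 'a::euclidean_space"
  assumes F: "finite F" and unb: "\<not> bounded {x. \<forall>i\<in>F. v i \<bullet> x \<le> 1}"
  shows "\<exists>u. u \<noteq> 0 \<and> (\<forall>i\<in>F. v i \<bullet> u \<le> 0)"
proof (rule ccontr)
  assume n: "\<not> ?thesis"
  define g where "g u = (\<Sum>i\<in>F. max 0 (v i \<bullet> u))" for u
  have pos: "0 < g u" if u: "norm u = 1" for u
  proof -
    have "u \<noteq> 0" using u by auto
    then obtain i where i: "i \<in> F" "0 < v i \<bullet> u" using n by force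
    then have "max 0 (v i \<bullet> u) \<le> g u" unfolding g_def by (intro member_le_sum F) auto
    then show ?thesis using i by linarith
  qed
  have "continuous_on (sphere 0 1) g" unfolding g_def by (intro continuous_intros)
  moreover have "sphere (0::'a) 1 \<noteq> {}" using nonempty_Basis norm_Basis by (metis mem_sphere_0 empty_iff ex_in_conv)
  ultimately obtain e where e: "e \<in> sphere 0 1" "\<And>u. u \<in> sphere 0 1 \<Longrightarrow> g e \<le> g u"
    using continuous_attains_inf[OF compact_sphere] by metis
  have m: "0 < g e" using pos e(1) by simp
  have "norm x \<le> card F / g e" if x: "\<forall>i\<in>F. v i \<bullet> x \<le> 1" for x
  proof (cases "x = 0")
    case False
    have "g e \<le> g ((1 / norm x) *\<^sub>R x)" by (rule e(2)) (use False in simp)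
    also have "\<dots> = (\<Sum>i\<in>F. (1 / norm x) * max 0 (v i \<bullet> x))" unfolding g_def
      using False by (intro sum.cong refl) (simp add: max_def field_simps)
    also have "\<dots> \<le> (\<Sum>i\<in>F. 1 / norm x)"
      by (intro sum_mono) (use x in \<open>auto simp: divide_right_mono\<close>)
    finally show ?thesis using False m by (simp add: field_simps)
  qed (use m in simp)
  then show False using unb by (auto simp: bounded_iff)
qed

lemma interior_polyhedron:
  fixes v :: "'i \<Rightarrow> 'a::euclidean_space"
  assumes I: "finite I" and nz: "\<And>i. i \<in> I \<Longrightarrow> v i \<noteq> 0"
  shows "interior {x. \<forall>i\<in>I. v i \<bullet> x \<le> 1} = {x. \<forall>i\<in>I. v i \<bullet> x < 1}"
proof -
  have e: "{x. \<forall>i\<in>I. v i \<bullet> x \<le> 1} = (\<Inter>i\<in>I. {x. v i \<bullet> x \<le> 1})" by auto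
  have "interior (\<Inter>i\<in>I. {x. v i \<bullet> x \<le> 1}) = (\<Inter>i\<in>I. interior {x. v i \<bullet> x \<le> 1})"
    using I by (induction I) (simp_all add: interior_Int)
  also have "\<dots> = {x. \<forall>i\<in>I. v i \<bullet> x < 1}" using nz by auto
  finally show ?thesis unfolding e .
qed

text \<open>The interior origin makes all offsets positive, so they can be scaled to 1. Boundedness
  of \<open>P\<close> yields balance, and unboundedness after omitting one halfspace yields the
  separators.\<close>

lemma primitive_polytope_normals:
  fixes P :: "'a::euclidean_space set"
  assumes P: "polytope P" "0 \<in> interior P" and prim: "primitive P"
  obtains v :: "'a set \<Rightarrow> 'a" where
    "P = {x. \<forall>H\<in>facet_halfspaces P. v H \<bullet> x \<le> 1}"
    "interior P = {x. \<forall>H\<in>facet_halfspaces P. v H \<bullet> x < 1}"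
    "\<And>u. \<forall>H\<in>facet_halfspaces P. 0 \<le> v H \<bullet> u \<Longrightarrow> u = 0"
    "\<And>H. H \<in> facet_halfspaces P \<Longrightarrow> \<exists>u. separator UNIV v (facet_halfspaces P) H u"
proof -
  define I where "I = facet_halfspaces P"
  have int: "interior P \<noteq> {}" using P(2) by auto
  note fin = polytope_facet_halfspaces(1)[OF P(1) int, folded I_def] and inter = polytope_facet_halfspaces(2)[OF P(1) int, folded I_def]
  have "\<exists>w. w \<noteq> 0 \<and> H = {x. w \<bullet> x \<le> 1}" if H: "H \<in> I" for H
  proof -
    obtain a b where ab: "a \<noteq> 0" "H = {x. a \<bullet> x \<le> b}" "P \<subseteq> H" using H unfolding I_def facet_halfspaces_def by blast
    have "0 \<in> interior {x. a \<bullet> x \<le> b}" using interior_mono[OF ab(3)] P(2) ab(2) by auto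
    then have "0 < b" using ab(1) by simp
    then show ?thesis using ab(1,2) by (intro exI[of _ "a /\<^sub>R b"]) (auto simp: field_simps)
  qed
  then obtain v where v: "\<And>H. H \<in> I \<Longrightarrow> v H \<noteq> 0 \<and> H = {x. v H \<bullet> x \<le> 1}" by metis
  have sub: "\<Inter>\<G> = {x. \<forall>H\<in>\<G>. v H \<bullet> x \<le> 1}" if "\<G> \<subseteq> I" for \<G>
  proof -
    have "x \<in> H \<longleftrightarrow> v H \<bullet> x \<le> 1" if "H \<in> \<G>" for x H using v[of H] that \<open>\<G> \<subseteq> I\<close> by blast
    then show ?thesis by blast
  qed
  have P_eq: "P = {x. \<forall>H\<in>I. v H \<bullet> x \<le> 1}" using sub[of I] inter by simp
  have bnd: "bounded P" using P(1) polytope_imp_bounded by blast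
  have ray: False if u: "u \<noteq> 0" "\<And>H. H \<in> I \<Longrightarrow> v H \<bullet> u \<le> 0" for u
  proof -
    obtain N where N: "\<And>x. x \<in> P \<Longrightarrow> norm x \<le> N" using bnd by (auto simp: bounded_iff)
    define t where "t = (\<bar>N\<bar> + 1) / norm u"
    have "0 \<le> t" unfolding t_def by simp
    have "t *\<^sub>R u \<in> P" unfolding P_eq
    proof (intro CollectI ballI)
      fix H assume "H \<in> I"
      have "t * (v H \<bullet> u) \<le> 0" using u(2)[OF \<open>H \<in> I\<close>] \<open>0 \<le> t\<close> by (simp add: mult_nonneg_nonpos)
      then show "v H \<bullet> (t *\<^sub>R u) \<le> 1" by simp
    qed
    then have "norm (t *\<^sub>R u) \<le> N" by (rule N)
    then show False using u(1) unfolding t_def by simp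
  qed
  show thesis
  proof (rule that[of v], unfold I_def[symmetric])
    show "P = {x. \<forall>H\<in>I. v H \<bullet> x \<le> 1}" by (rule P_eq)
    show "interior P = {x. \<forall>H\<in>I. v H \<bullet> x < 1}"
      using interior_polyhedron[OF fin, of v] v P_eq by auto
    show "u = 0" if "\<forall>H\<in>I. 0 \<le> v H \<bullet> u" for u
      using ray[of "- u"] that by auto
    fix H assume H: "H \<in> I"
    have "\<not> bounded {x. \<forall>G\<in>I - {H}. v G \<bullet> x \<le> 1}"
      using prim H sub[of "I - {H}"] unfolding primitive_def I_def by auto
    from unbounded_polyhedron_direction[OF finite_Diff[OF fin] this]
    obtain u where u: "u \<noteq> 0" "\<forall>G\<in>I - {H}. v G \<bullet> u \<le> 0" by (elim exE conjE)
    \<comment> \<open>Otherwise \<open>P\<close> itself would contain the ray along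
      \<open>u\<close>. The sign convention of \<open>separator\<close> then asks for
      \<open>- u\<close>.\<close>
    have "0 < v H \<bullet> u"
    proof (rule ccontr)
      assume n: "\<not> 0 < v H \<bullet> u"
      have "v G \<bullet> u \<le> 0" if "G \<in> I" for G using u(2) n that by (cases "G = H") auto
      then show False by (rule ray[OF u(1)])
    qed
    then show "\<exists>u. separator UNIV v I H u" unfolding separator_def using u(2)
      by (intro exI[of _ "- u"]) auto
  qed
qed

text \<open>The facets active at a boundary point \<open>x\<close> form a feasible set with witness
  \<open>- x\<close>, which extends to a maximal one. The direction chosen for that maximal set
  enters the interior from \<open>x\<close>.\<close>

lemma Ill_le_card_max_feasible:
  fixes P :: "'a::euclidean_space set"
  assumes I: "finite I" and P: "P = {x. \<forall>i\<in>I. v i \<bullet> x \<le> 1}" "interior P = {x. \<forall>i\<in>I. v i \<bullet> x < 1}"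
  shows "Ill P \<le> enat (card (max_feasible UNIV v I))"
proof -
  let ?F = "max_feasible UNIV v I"
  have "\<forall>J\<in>?F. \<exists>u. \<forall>i\<in>J. v i \<bullet> u < 0" using max_feasibleD(2) unfolding feasible_def by blast
  then obtain w where w: "\<And>J i. J \<in> ?F \<Longrightarrow> i \<in> J \<Longrightarrow> v i \<bullet> w J < 0" by metis
  define d where "d J = w J /\<^sub>R norm (w J)" for J
  \<comment> \<open>For the empty set the witness may be 0 and cannot be normalized; boundary points
    always have a nonempty active set.\<close>
  define U where "U = d ` {J\<in>?F. J \<noteq> {}}"
  have finU: "finite U" unfolding U_def using I by simp
  have nz: "w J \<noteq> 0" if "J \<in> ?F" "J \<noteq> {}" for J using w[OF that(1)] that(2) by force
  have "norm (d J) = 1" if "J \<in> ?F" "J \<noteq> {}" for J using nz[OF that] unfolding d_def by simp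
  then have "U \<subseteq> sphere 0 1" unfolding U_def by (metis (mono_tags, lifting) image_subsetI mem_Collect_eq mem_sphere_0)
  moreover have "illuminates U P"
    unfolding illuminates_def
  proof
    fix x assume x: "x \<in> frontier P"
    have "P = (\<Inter>i\<in>I. {x. v i \<bullet> x \<le> 1})" unfolding P(1) by auto
    then have "closed P" by (simp add: closed_INT closed_halfspace_le)
    then have "x \<in> P" "x \<notin> interior P" using x unfolding frontier_def by auto
    define A where "A = {i\<in>I. v i \<bullet> x = 1}"
    have A0: "A \<noteq> {}" using \<open>x \<in> P\<close> \<open>x \<notin> interior P\<close> unfolding P(2) unfolding P(1) A_def by force
    have fA: "feasible UNIV v A" unfolding feasible_def A_def by (intro bexI[of _ "- x"]) auto
    have AI: "A \<subseteq> I" unfolding A_def by auto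
    obtain J where "A \<subseteq> J" "J \<in> ?F" by (rule feasible_extend[OF I AI fA])
    then have J: "A \<subseteq> J" "J \<in> ?F" "J \<noteq> {}" using A0 by auto
    have neg: "v i \<bullet> d J < 0" if "i \<in> A" for i
    proof -
      have "v i \<bullet> w J < 0" using w J that by auto
      then show ?thesis using nz[OF J(2,3)] unfolding d_def by (simp add: mult_pos_neg)
    qed
    have "\<forall>\<^sub>F t in at_right (0::real). \<forall>i\<in>I. v i \<bullet> x + t * (v i \<bullet> d J) < 1"
    proof (intro eventually_ball_finite[OF I] ballI)
      fix i assume i: "i \<in> I"
      show "\<forall>\<^sub>F t in at_right (0::real). v i \<bullet> x + t * (v i \<bullet> d J) < 1"
      proof (cases "i \<in> A")
        case True
        then have "v i \<bullet> x = 1" unfolding A_def by simp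
        then show ?thesis using eventually_at_right_less[of "0::real"] neg[OF True]
          by (auto elim!: eventually_mono simp: mult_pos_neg)
      next
        case False
        then have lt: "v i \<bullet> x < 1" using \<open>x \<in> P\<close> i unfolding P(1) A_def by force
        have "((\<lambda>t. v i \<bullet> x + t * (v i \<bullet> d J)) \<longlongrightarrow> v i \<bullet> x + 0 * (v i \<bullet> d J)) (at_right 0)"
          by (intro tendsto_intros)
        then show ?thesis by (rule order_tendstoD) (use lt in simp)
      qed
    qed
    then obtain t :: real where t: "0 < t" "\<forall>i\<in>I. v i \<bullet> x + t * (v i \<bullet> d J) < 1"
      using eventually_happens[OF eventually_conj[OF eventually_at_right_less[of "0::real"]]]
      by (auto simp: trivial_limit_at_right_real)
    have "x + t *\<^sub>R d J \<in> interior P" unfolding P(2) using t(2) by (simp add: inner_add_right)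
    moreover have "x + t *\<^sub>R d J \<in> {x + t *\<^sub>R d J | t. 0 \<le> t}" using t(1) less_imp_le by blast
    ultimately have "illuminated_by P x (d J)" unfolding illuminated_by_def by blast
    then show "\<exists>u\<in>U. illuminated_by P x u" using J unfolding U_def by auto
  qed
  ultimately have "Ill P \<le> enat (card U)"
    unfolding Ill_def using finU by (intro Inf_lower) blast
  also have "card U \<le> card ?F"
  proof -
    have "card U \<le> card {J\<in>?F. J \<noteq> {}}" unfolding U_def by (rule card_image_le) (use I in simp)
    also have "\<dots> \<le> card ?F" by (rule card_mono) (use I in auto)
    finally show ?thesis .
  qed
  finally show ?thesis by simp
qed

section \<open>Cubes: the lower bound and the recognition of parallelotopes\<close>

text \<open>A direction that illuminates a vertex determines it: in cube coordinates, the vertex is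
  maximal exactly where the direction is negative. So the 2^d vertices need distinct
  directions.\<close>

lemma Ill_ge_linear_image_cube:
  fixes C P :: "'a::euclidean_space set"
  assumes C: "is_cube C" and f: "linear f" "bij f" and P: "P = f ` C"
  shows "enat (2 ^ DIM('a)) \<le> Ill P"
proof -
  obtain s and g :: "'a \<Rightarrow> 'a" where s: "s > 0" and g: "\<And>x y. dist (g x) (g y) = dist x y"
    and C_eq: "C = g ` {x. \<forall>i\<in>Basis. 0 \<le> x \<bullet> i \<and> x \<bullet> i \<le> s}"
    using C unfolding is_cube_def by blast
  \<comment> \<open>The isometry is a translation after an orthogonal map, so \<open>P\<close> is a
    translate of the box under a linear bijection.\<close>
  define L where "L x = g x - g 0" for x
  have "orthogonal_transformation L" unfolding orthogonal_transformation_isometry L_def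
    using g by (simp add: dist_norm)
  then have L: "linear L" "bij L"
    using orthogonal_transformation_linear orthogonal_transformation_bij by blast+
  define F where "F = f \<circ> L"
  have F: "linear F" "bij F" unfolding F_def using L f by (auto simp: linear_compose bij_comp)
  have injF: "inj F" and surjF: "surj F" using F(2) by (auto simp: bij_def)
  let ?B = "{x::'a. \<forall>i\<in>Basis. 0 \<le> x \<bullet> i \<and> x \<bullet> i \<le> s}"
  have Bc: "?B = cbox 0 (\<Sum>i\<in>Basis. s *\<^sub>R i)" by (auto simp: mem_box inner_sum_left_Basis)
  define p where "p = f (g 0)"
  have fg: "f (g x) = p + F x" for x
    unfolding p_def F_def L_def using f(1) by (simp add: linear_diff)
  have P_eq: "P = (+) p ` (F ` ?B)" unfolding P C_eq image_image fg ..
  have intP: "interior P = (+) p ` (F ` {x. \<forall>i\<in>Basis. 0 < x \<bullet> i \<and> x \<bullet> i < s})"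
  proof -
    have "interior ?B = {x. \<forall>i\<in>Basis. 0 < x \<bullet> i \<and> x \<bullet> i < s}"
      unfolding Bc interior_cbox by (auto simp: mem_box inner_sum_left_Basis)
    then show ?thesis unfolding P_eq interior_translation interior_injective_linear_image[OF F(1) injF] by simp
  qed
  have closP: "closed P" unfolding P_eq Bc
    by (intro closed_translation closed_injective_linear_image[OF _ F(1) injF] closed_cbox)
  define y where "y A = (\<Sum>i\<in>A. s *\<^sub>R i)" for A :: "'a set"
  have yi: "y A \<bullet> i = (if i \<in> A then s else 0)" if "i \<in> Basis" "A \<subseteq> Basis" for i A
  proof -
    have fA: "finite A" using that(2) finite_subset finite_Basis by blast
    have "y A \<bullet> i = (\<Sum>j\<in>A. if j = i then s else 0)"
      unfolding y_def inner_sum_left using that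
      by (intro sum.cong refl) (auto simp: inner_Basis subset_iff)
    then show ?thesis using fA by simp
  qed
  define X where "X A = p + F (y A)" for A
  have shift: "X A + t *\<^sub>R F e = p + F (y A + t *\<^sub>R e)" for A t e
    unfolding X_def using F(1) by (simp add: linear_add linear_scale)
  have in_int: "p + F z \<in> interior P \<longleftrightarrow> (\<forall>i\<in>Basis. 0 < z \<bullet> i \<and> z \<bullet> i < s)" for z
    unfolding intP using injF by (auto simp: inj_image_mem_iff image_iff inj_eq)
  have fr: "X A \<in> frontier P" if A: "A \<subseteq> Basis" for A
  proof -
    obtain b :: 'a where b: "b \<in> Basis" using nonempty_Basis by blast
    have "X A \<in> P" unfolding X_def P_eq using yi[OF _ A] s by auto
    moreover have "\<not> (0 < y A \<bullet> b \<and> y A \<bullet> b < s)" using yi[OF b A] by simp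
    then have "X A \<notin> interior P" unfolding X_def in_int using b by blast
    ultimately show ?thesis unfolding frontier_def using closP by simp
  qed
  have key: "A = {i\<in>Basis. e \<bullet> i < 0}" if A: "A \<subseteq> Basis" and ill: "illuminated_by P (X A) (F e)" for A e
  proof -
    obtain t where t: "0 \<le> t" "X A + t *\<^sub>R F e \<in> interior P" using ill unfolding illuminated_by_def by auto
    then have *: "0 < y A \<bullet> i + t * (e \<bullet> i) \<and> y A \<bullet> i + t * (e \<bullet> i) < s" if "i \<in> Basis" for i
      using that unfolding shift in_int by (simp add: inner_add_left)
    show ?thesis
    proof (intro equalityI subsetI)
      fix i assume i: "i \<in> A"
      then have "t * (e \<bullet> i) < 0" using *[of i] yi[of i A] A by auto
      then show "i \<in> {i\<in>Basis. e \<bullet> i < 0}" using t(1) i A by (auto simp: mult_less_0_iff)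
    next
      fix i assume i: "i \<in> {i\<in>Basis. e \<bullet> i < 0}"
      show "i \<in> A"
      proof (rule ccontr)
        assume "i \<notin> A"
        then have "0 < t * (e \<bullet> i)" using *[of i] yi[of i A] A i by auto
        then show False using t(1) i by (auto simp: zero_less_mult_iff)
      qed
    qed
  qed
  have "2 ^ DIM('a) \<le> card U" if U: "finite U" "illuminates U P" for U
  proof -
    define h where "h u = {i\<in>Basis. inv F u \<bullet> i < 0}" for u
    have "Pow Basis \<subseteq> h ` U"
    proof
      fix A :: "'a set" assume "A \<in> Pow Basis"
      then have A: "A \<subseteq> Basis" by simp
      obtain u where u: "u \<in> U" "illuminated_by P (X A) u" using fr[OF A] U(2) unfolding illuminates_def by blast
      have "illuminated_by P (X A) (F (inv F u))" using u(2) surjF by (simp add: surj_f_inv_f)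
      then have "A = h u" unfolding h_def by (rule key[OF A])
      then show "A \<in> h ` U" using u(1) by blast
    qed
    then have "card (Pow (Basis::'a set)) \<le> card (h ` U)" using U(1) by (intro card_mono) auto
    also have "\<dots> \<le> card U" by (rule card_image_le[OF U(1)])
    finally show ?thesis by (simp add: card_Pow)
  qed
  then show ?thesis unfolding Ill_def by (intro Inf_greatest) auto
qed

text \<open>The witnesses are, up to scaling, a dual basis for the normals \<open>v k\<close> with
  \<open>k \<in> K\<close>. Each partner is seen by one witness only, hence is a negative multiple
  of \<open>v k\<close>, and \<open>P\<close> is an intersection of d slabs.\<close>

lemma paired_imp_linear_image_cube:
  fixes v :: "'i \<Rightarrow> 'a::euclidean_space"
  assumes P: "P = {x. \<forall>i\<in>I. v i \<bullet> x \<le> 1}"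
    and bnd: "\<And>u. \<forall>i\<in>I. 0 \<le> v i \<bullet> u \<Longrightarrow> u = 0" and "paired UNIV v I I"
  shows "\<exists>C (f::'a \<Rightarrow> 'a). is_cube C \<and> linear f \<and> bij f \<and> P = f ` C"
proof -
  obtain K \<sigma> where K: "K \<subseteq> I" "bij_betw \<sigma> K (I - K)" "card K = DIM('a)"
    and Ku: "\<forall>k\<in>K. \<exists>u\<in>UNIV. v k \<bullet> u < 0 \<and> 0 < v (\<sigma> k) \<bullet> u \<and> (\<forall>i\<in>I - {k, \<sigma> k}. v i \<bullet> u = 0)"
    using assms(3) unfolding paired_def by auto
  have finK: "finite K" using K(3) by (metis DIM_positive card.infinite less_irrefl)
  obtain e where e: "bij_betw e (Basis::'a set) K"
    using finite_same_card_bij[OF finite_Basis finK] K(3) by auto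
  have eK: "e b \<in> K" if "b \<in> Basis" for b using e that by (auto simp: bij_betw_def)
  have \<sigma>K: "\<sigma> k \<in> I" "\<sigma> k \<notin> K" if "k \<in> K" for k using K(2) that by (auto simp: bij_betw_def)
  have e_inj: "e b = e c \<longleftrightarrow> b = c" if "b \<in> Basis" "c \<in> Basis" for b c
    using e that by (auto simp: bij_betw_def inj_on_def)
  have \<sigma>_inj: "\<sigma> k = \<sigma> l \<longleftrightarrow> k = l" if "k \<in> K" "l \<in> K" for k l
    using K(2) that by (auto simp: bij_betw_def inj_on_def)
  obtain u where u: "\<And>k. k \<in> K \<Longrightarrow> v k \<bullet> u k < 0 \<and> 0 < v (\<sigma> k) \<bullet> u k \<and> (\<forall>i\<in>I - {k, \<sigma> k}. v i \<bullet> u k = 0)"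
    using Ku by metis
  define a where "a b = v (e b)" for b
  define a' where "a' b = v (\<sigma> (e b))" for b
  define w where "w b = u (e b)" for b
  have aw: "a b \<bullet> w b < 0" "0 < a' b \<bullet> w b" if "b \<in> Basis" for b
    using u[OF eK[OF that]] unfolding a_def a'_def w_def by auto
  have aw0: "a c \<bullet> w b = 0" "a' c \<bullet> w b = 0" if bc: "b \<in> Basis" "c \<in> Basis" "c \<noteq> b" for b c
  proof -
    have "e c \<in> I - {e b, \<sigma> (e b)}" "\<sigma> (e c) \<in> I - {e b, \<sigma> (e b)}"
      using bc e_inj[of c b] \<sigma>_inj[of "e c" "e b"] eK[of b] eK[of c] \<sigma>K[of "e b"] \<sigma>K[of "e c"] K(1) by auto
    then show "a c \<bullet> w b = 0" "a' c \<bullet> w b = 0"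
      using u[OF eK[OF bc(1)]] unfolding a_def a'_def w_def by blast+
  qed
  define W where "W x = (\<Sum>b\<in>Basis. (w b \<bullet> x) *\<^sub>R b)" for x :: 'a
  have linW: "linear W" unfolding W_def
    by (rule linearI) (simp_all add: inner_add_right scaleR_add_left sum.distrib scaleR_sum_right)
  have "surj W"
  proof (rule surjI)
    fix y :: 'a
    let ?x = "\<Sum>c\<in>Basis. ((y \<bullet> c) / (a c \<bullet> w c)) *\<^sub>R a c"
    have "w b \<bullet> ?x = y \<bullet> b" if b: "b \<in> Basis" for b
    proof -
      have "w b \<bullet> ?x = (\<Sum>c\<in>Basis. if c = b then y \<bullet> b else 0)"
        unfolding inner_sum_right
        by (intro sum.cong refl) (use b aw[OF b] aw0[OF b] in \<open>auto simp: inner_commute\<close>)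
      then show ?thesis using b by simp
    qed
    then show "W ?x = y" unfolding W_def by (simp add: euclidean_representation)
  qed
  then have injW: "inj W" using linear_surj_imp_inj[OF linW] by blast
  \<comment> \<open>The only factor for which \<open>a' b + \<mu> b *\<^sub>R a b\<close> can vanish
    on \<open>w b\<close>; it vanishes on the other witnesses anyway.\<close>
  define \<mu> where "\<mu> b = (a' b \<bullet> w b) / (- (a b \<bullet> w b))" for b
  have \<mu>: "0 < \<mu> b" if "b \<in> Basis" for b unfolding \<mu>_def using aw[OF that] by (intro divide_pos_pos) simp_all
  have a': "a' b = - (\<mu> b *\<^sub>R a b)" if b: "b \<in> Basis" for b
  proof -
    have "w c \<bullet> (a' b + \<mu> b *\<^sub>R a b) = 0" if c: "c \<in> Basis" for c
    proof (cases "c = b")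
      case True
      then show ?thesis using aw[OF b] unfolding \<mu>_def by (simp add: inner_diff_right inner_commute[of "w b"])
    next
      case False
      then show ?thesis using aw0[OF c b] by (simp add: inner_add_right inner_commute)
    qed
    then have "W (a' b + \<mu> b *\<^sub>R a b) = W 0" unfolding W_def by simp
    then show ?thesis using injW by (simp add: inj_eq eq_neg_iff_add_eq_0)
  qed
  have I_eq: "I = e ` Basis \<union> (\<lambda>b. \<sigma> (e b)) ` Basis"
  proof -
    have "e ` Basis = K" "\<sigma> ` K = I - K" using e K(2) by (auto simp: bij_betw_def)
    moreover have "(\<lambda>b. \<sigma> (e b)) ` Basis = \<sigma> ` e ` Basis" by (simp add: image_image)
    ultimately show ?thesis using K(1) by auto
  qed
  have P_iff: "x \<in> P \<longleftrightarrow> (\<forall>b\<in>Basis. a b \<bullet> x \<le> 1 \<and> - (\<mu> b * (a b \<bullet> x)) \<le> 1)" for x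
  proof -
    have "x \<in> P \<longleftrightarrow> (\<forall>b\<in>Basis. a b \<bullet> x \<le> 1 \<and> a' b \<bullet> x \<le> 1)"
      unfolding P I_eq a_def a'_def by auto
    then show ?thesis using a' by simp
  qed
  \<comment> \<open>The slab of \<open>b\<close> is -1/\<mu> \<le> \<open>a b \<bullet> x\<close>
    \<le> 1, of width (\<mu> + 1)/\<mu>; the factor rescales it to width 1.\<close>
  define G where "G x = (\<Sum>b\<in>Basis. (\<mu> b / (\<mu> b + 1) * (a b \<bullet> x)) *\<^sub>R b)" for x :: 'a
  have Gb: "G x \<bullet> b = \<mu> b / (\<mu> b + 1) * (a b \<bullet> x)" if "b \<in> Basis" for x b
    unfolding G_def using that by (simp add: inner_sum_left_Basis)
  have linG: "linear G" unfolding G_def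
    by (rule linearI) (simp_all add: inner_add_right distrib_left scaleR_add_left sum.distrib scaleR_sum_right mult.left_commute)
  have injG: "inj G"
  proof (rule linear_injective_0[OF linG, THEN iffD2], intro allI impI)
    fix x assume x: "G x = 0"
    have "a b \<bullet> x = 0" if "b \<in> Basis" for b
      using Gb[OF that, of x] x \<mu>[OF that] by simp
    then have "\<forall>i\<in>I. 0 \<le> v i \<bullet> x" unfolding I_eq using a' unfolding a_def a'_def by auto
    then show "x = 0" by (rule bnd)
  qed
  have surjG: "surj G" using linear_injective_imp_surjective[OF linG injG] by blast
  \<comment> \<open>After rescaling the lower face lies at -1/(\<mu> + 1). The shift goes into the
    position of the cube, so that the map onto \<open>P\<close> stays linear.\<close>
  define c where "c = (\<Sum>b\<in>Basis. (1 / (\<mu> b + 1)) *\<^sub>R b)"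
  have cb: "c \<bullet> b = 1 / (\<mu> b + 1)" if "b \<in> Basis" for b
    unfolding c_def using that by (simp add: inner_sum_left_Basis)
  have GP: "x \<in> P \<longleftrightarrow> (\<forall>b\<in>Basis. 0 \<le> (G x + c) \<bullet> b \<and> (G x + c) \<bullet> b \<le> 1)" for x
    unfolding P_iff
  proof (intro ball_cong refl)
    fix b :: 'a assume b: "b \<in> Basis"
    have e: "(G x + c) \<bullet> b = (\<mu> b * (a b \<bullet> x) + 1) / (\<mu> b + 1)"
      unfolding inner_add_left Gb[OF b] cb[OF b] by (simp add: add_divide_distrib)
    show "(a b \<bullet> x \<le> 1 \<and> - (\<mu> b * (a b \<bullet> x)) \<le> 1) = (0 \<le> (G x + c) \<bullet> b \<and> (G x + c) \<bullet> b \<le> 1)"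
      unfolding e using \<mu>[OF b] by (auto simp: divide_le_eq_1 zero_le_divide_iff)
  qed
  define Q where "Q = (\<lambda>y. y - c) ` {x. \<forall>i\<in>Basis. 0 \<le> x \<bullet> i \<and> x \<bullet> i \<le> 1}"
  have "is_cube Q" unfolding is_cube_def Q_def
    by (intro exI[of _ 1] conjI exI[of _ "\<lambda>y. y - c"]) (auto simp: dist_norm)
  moreover have "linear (inv G)" using inj_linear_imp_inv_linear[OF linG injG] .
  moreover have "bij (inv G)" using bij_imp_bij_inv[OF bijI[OF injG surjG]] .
  moreover have "P = inv G ` Q"
  proof -
    have "G ` P = Q"
    proof (intro equalityI subsetI)
      fix y assume "y \<in> G ` P"
      then obtain x where "x \<in> P" "y = G x" by auto
      then have "G x + c \<in> {x. \<forall>i\<in>Basis. 0 \<le> x \<bullet> i \<and> x \<bullet> i \<le> 1}" using GP by auto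
      then show "y \<in> Q" unfolding Q_def \<open>y = G x\<close> by (rule rev_image_eqI) simp
    next
      fix y assume "y \<in> Q"
      then obtain z where z: "\<forall>i\<in>Basis. 0 \<le> z \<bullet> i \<and> z \<bullet> i \<le> 1" "y = z - c" unfolding Q_def by auto
      obtain x where "y = G x" using surjG by (metis surjD)
      moreover have "x \<in> P" unfolding GP using z calculation by (metis diff_add_cancel)
      ultimately show "y \<in> G ` P" by blast
    qed
    then show ?thesis using injG by (metis inv_f_f image_inv_f_f)
  qed
  ultimately show ?thesis by blast
qed

theorem theorem2:
  fixes P :: "'a::euclidean_space set"
  assumes "polytope P" and "0 \<in> interior P" and "primitive P"
  shows "Ill P \<le> enat (2 ^ DIM('a)) \<and>
    (Ill P = enat (2 ^ DIM('a)) \<longleftrightarrow>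
      (\<exists>C (f::'a \<Rightarrow> 'a). is_cube C \<and> linear f \<and> bij f \<and> P = f ` C))"
proof -
  define I where "I = facet_halfspaces P"
  obtain v :: "'a set \<Rightarrow> 'a" where P: "P = {x. \<forall>H\<in>I. v H \<bullet> x \<le> 1}" "interior P = {x. \<forall>H\<in>I. v H \<bullet> x < 1}"
    and bnd: "\<And>u. \<forall>H\<in>I. 0 \<le> v H \<bullet> u \<Longrightarrow> u = 0"
    and sep: "\<And>H. H \<in> I \<Longrightarrow> \<exists>u. separator UNIV v I H u"
    using primitive_polytope_normals[OF assms] unfolding I_def by blast
  have fin: "finite I" unfolding I_def using polytope_facet_halfspaces(1) assms by blast
  define N where "N = card (max_feasible UNIV v I)"
  have "balanced UNIV v I" unfolding balanced_def using bnd by fastforce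
  then have tw: "total_weight UNIV v I {} \<le> 2 ^ DIM('a)"
    "total_weight UNIV v I {} = 2 ^ DIM('a) \<Longrightarrow> paired UNIV v I I"
    using total_weight_le[of UNIV I "{}" v] fin sep by auto
  \<comment> \<open>With no marks every maximal set has weight 1.\<close>
  have N: "total_weight UNIV v I {} = real N" unfolding total_weight_def N_def by simp
  have "real N \<le> real (2 ^ DIM('a))" using tw(1) N by simp
  then have "N \<le> 2 ^ DIM('a)" by (simp only: of_nat_le_iff)
  moreover have IN: "Ill P \<le> enat N" unfolding N_def by (rule Ill_le_card_max_feasible[OF fin P])
  ultimately have le: "Ill P \<le> enat (2 ^ DIM('a))" by (meson enat_ord_simps(1) order_trans)
  moreover have "\<exists>C (f::'a \<Rightarrow> 'a). is_cube C \<and> linear f \<and> bij f \<and> P = f ` C" if "Ill P = enat (2 ^ DIM('a))"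
  proof -
    \<comment> \<open>Here 2^d = \<open>Ill P\<close> \<le> \<open>N\<close> \<le> 2^d.\<close>
    have "N = 2 ^ DIM('a)" using that IN \<open>N \<le> 2 ^ DIM('a)\<close> by simp
    then have pr: "paired UNIV v I I" using tw(2) N by simp
    show ?thesis by (rule paired_imp_linear_image_cube[OF P(1) _ pr]) (erule bnd)
  qed
  moreover have "Ill P = enat (2 ^ DIM('a))" if "is_cube C" "linear f" "bij f" "P = f ` C" for C and f :: "'a \<Rightarrow> 'a"
    using le Ill_ge_linear_image_cube[OF that] by simp
  ultimately show ?thesis by blast
qed

end
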